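(* Let $k\ge2$ be a fixed integer, $\lambda=k-1$, and let $n$ range over multiples of $k$. Let $a=a(n)>0$ satisfy $a^{-1}\log^{-1/3}n=o(1)$ as $n\to\infty$, and let $\xi=\left(\mathbb{E}_n^{\{0,k\}}(\mathbf{T})\right)^a$. Let $f_1,f_2,\dots$ be independent uniformly random $\{0,k\}$-mappings on $n$ nodes, and let $\mathbf{N}=\min\{t:\mathbf{T}(f_t)\ge\xi\}$. Then for sufficiently large $n$, $$\mathbb{E}(\mathbf{N})>\exp\left(\frac{\lambda n^{1/3}}{3\log^6 n}\right),$$ and in addition $$\mathbb{P}\left(\mathbf{N}\le\exp\left(\frac{\lambda n^{1/3}}{4\log^6n}\right)\right)\le\exp\left(-\frac{\lambda n^{1/3}}{12\log^6 n}\right).$$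
   Context: A $\{0,k\}$-mapping on $n$ nodes is a function $f:\{1,\dots,n\}\to\{1,\dots,n\}$ with $|f^{-1}(y)|\in\{0,k\}$ for every $y$. $\mathbf{T}(f)$ is the least common multiple of the lengths of the cycles of $f$. $\mathbb{E}_n^{\{0,k\}}$ denotes expectation under the uniform distribution on $\{0,k\}$-mappings on $\{1,\dots,n\}$. *)

theory Defs
  imports
    "HOL-Probability.Probability"
    "HOL-Combinatorics.Orbits"
    "HOL-Library.Landau_Symbols"
begin

text \<open>
  Self-maps of \<open>{1..n}\<close> are represented extensionally (as \<open>undefined\<close> outside \<open>{1..n}\<close>), so that
  they form a finite set.
\<close>

definition zero_k_mappings :: "nat \<Rightarrow> nat \<Rightarrow> (nat \<Rightarrow> nat) set" where
  "zero_k_mappings k n =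
     {f \<in> {1..n} \<rightarrow>\<^sub>E {1..n}. \<forall>y\<in>{1..n}. card {x \<in> {1..n}. f x = y} \<in> {0, k}}"

text \<open>
  The restriction \<open>C \<subseteq> {1..n}\<close> is needed because the junk value \<open>undefined\<close> might be
  a fixed point of \<open>f\<close> outside \<open>{1..n}\<close>.
\<close>

definition cycles :: "nat \<Rightarrow> (nat \<Rightarrow> nat) \<Rightarrow> nat set set" where
  "cycles n f = {C. C \<subseteq> {1..n} \<and> cyclic_on f C}"

definition T_lcm :: "nat \<Rightarrow> (nat \<Rightarrow> nat) \<Rightarrow> nat" where
  "T_lcm n f = Lcm (card ` cycles n f)"

definition expected_T :: "nat \<Rightarrow> nat \<Rightarrow> real" where
  "expected_T k n = (\<integral>f. real (T_lcm n f) \<partial>uniform_count_measure (zero_k_mappings k n))"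

definition iid_uniform_mappings ::
    "nat \<Rightarrow> nat \<Rightarrow> 'w measure \<Rightarrow> (nat \<Rightarrow> 'w \<Rightarrow> (nat \<Rightarrow> nat)) \<Rightarrow> bool" where
  "iid_uniform_mappings k n M F \<longleftrightarrow>
     prob_space M \<and>
     prob_space.indep_vars M (\<lambda>_. count_space (zero_k_mappings k n)) F {1..} \<and>
     (\<forall>t\<ge>1. distr M (count_space (zero_k_mappings k n)) (F t)
              = uniform_count_measure (zero_k_mappings k n))"

text \<open>
  The waiting time is \<open>\<infinity>\<close> (the infimum of the empty set in \<^typ>\<open>enat\<close>) on sample points where the
  threshold is never reached.
\<close>

definition waiting_time :: "nat \<Rightarrow> real \<Rightarrow> (nat \<Rightarrow> 'w \<Rightarrow> (nat \<Rightarrow> nat)) \<Rightarrow> 'w \<Rightarrow> enat" where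
  "waiting_time n \<xi> F \<omega> = Inf (enat ` {t. t \<ge> 1 \<and> real (T_lcm n (F t \<omega>)) \<ge> \<xi>})"

text \<open>The filter for \<open>n \<rightarrow> \<infinity>\<close> through the multiples of \<open>k\<close>.\<close>

definition at_top_multiples :: "nat \<Rightarrow> nat filter" where
  "at_top_multiples k = inf at_top (principal {n. k dvd n})"

end

theory Submission
  imports Defs "HOL-Computational_Algebra.Primes" "HOL-Real_Asymp.Real_Asymp"
begin

text \<open>
  Given its set of periodic points, a \<open>{0,k}\<close>-mapping acts on them as a uniformly random permutation.
  Hence the number \<open>c\<close> of cycles satisfies \<open>E(2\<^sup>c) \<le> n + 1\<close>, and since \<open>T \<le> n\<^sup>c\<close>, Markov's inequality gives
  \<open>P(T \<ge> \<xi>) \<le> (n + 1) exp(- ln 2 ln \<xi> / ln n)\<close>.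

  A crude lower bound on \<open>E(T)\<close> then suffices. With probability at least
  \<open>exp(- 2 k z\<^sup>2 / n) / n\<^sup>2\<close> there are at least \<open>z\<close> periodic points. A random permutation of \<open>m\<close> points has
  exactly one cycle of each length in a set \<open>Q\<close> of primes, plus one cycle through all remaining points, with
  probability at least \<open>1 / (m \<Prod>Q)\<close>. In that case \<open>T \<ge> \<Prod>Q\<close>, so each set \<open>Q\<close> of primes up to \<open>x\<close>, where
  \<open>x\<^sup>2 < z\<close>, contributes at least \<open>1 / m\<close> to the expectation, \<open>2 ^ \<pi>(x) / m\<close> in total.
  Choosing \<open>x = \<lfloor>n powr (1/3) / ln n\<rfloor>\<close> and using Chebyshev's bound on \<open>\<pi>(x)\<close> gives
  \<open>ln E(T) \<ge> n powr (1/3) / ln\<^sup>3 n\<close>, so that \<open>P(T \<ge> \<xi>)\<close> is far below \<open>exp(- \<lambda> n powr (1/3) / (3 ln\<^sup>6 n))\<close>.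
\<close>

subsection \<open>Chebyshev's lower bound for the number of primes\<close>

text \<open>The numbers \<open>1 / (Suc n * (n choose j))\<close> form Leibniz' harmonic triangle.
  The entry at \<open>(n, j + 1)\<close> is the difference of those at \<open>(n - 1, j)\<close> and
  \<open>(n, j)\<close>, so a number that all denominators in column \<open>j\<close> up to row
  \<open>n\<close> divide is also a multiple of the new denominator.\<close>

lemma Suc_mult_binomial_dvd_Lcm:
  "j \<le> n \<Longrightarrow> Suc n * (n choose j) dvd Lcm {1..Suc n}"
proof (induction j arbitrary: n)
  case 0
  then show ?case by (simp add: dvd_Lcm)
next
  case (Suc j)
  then obtain m where n: "n = Suc m" by (cases n) auto
  define d where "d = Lcm {1..Suc n}"
  define X where "X = Suc n * (n choose Suc j)"
  define B where "B = n * (m choose j)"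
  have "Suc n * (n choose j) dvd d"
    using Suc unfolding d_def by simp
  then obtain a where a: "d = Suc n * (n choose j) * a" ..
  have "B dvd Lcm {1..Suc m}"
    using Suc.IH[of m] Suc.prems n by (simp add: B_def)
  also have "Lcm {1..Suc m} dvd d"
    unfolding d_def n by (intro Lcm_subset) auto
  finally obtain b where b: "d = B * b" ..
  have absorb: "Suc j * (n choose Suc j) = B"
    unfolding B_def n by (rule Suc_times_binomial)
  have absorb_comp: "(n - j) * (n choose j) = B"
    using binomial_absorb_comp[of n j] by (simp add: B_def n)
  \<comment> \<open>The recursion of Leibniz' harmonic triangle, cleared of denominators.\<close>
  have "Suc j * int d = int X * Suc j * (int b - int a)"
  proof -
    have "int X * Suc j = int (Suc n) * int B"
      unfolding X_def absorb[symmetric] by (simp only: of_nat_mult mult_ac)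
    then have "int X * Suc j * (int b - int a) = int (Suc n) * int d - int (Suc n) * int B * int a"
      by (simp add: b algebra_simps)
    also have "int (Suc n) * int B * int a = (n - j) * int d"
      unfolding absorb_comp[symmetric] a by (simp only: of_nat_mult mult_ac)
    also have "int (Suc n) * int d - int (n - j) * int d = Suc j * int d"
      using Suc.prems by (simp add: of_nat_diff algebra_simps)
    finally show ?thesis by simp
  qed
  then have "int d = int X * (int b - int a)"
    by (simp add: mult.assoc mult.left_commute)
  then have "int X dvd int d" by simp
  then show ?case unfolding X_def d_def of_nat_dvd_iff .
qed

lemma Lcm_atLeastAtMost_pos: "Lcm {1..n::nat} > 0"
  by (intro Nat.gr0I) (auto simp: Lcm_0_iff)

text \<open>For odd \<open>n = 2 * m + 1\<close> the divisor
  \<open>Suc (2 * m) * (2 * m choose m)\<close> of the Lcm is already at least \<open>4 ^ m\<close>.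
  An even \<open>n\<close> is reduced to \<open>n - 1\<close>; the factor 4 absorbs this
  loss.\<close>

lemma two_power_le_Lcm: "2 ^ n \<le> 4 * Lcm {1..n::nat}"
proof -
  have odd: "4 ^ m \<le> Lcm {1..Suc (2 * m)}" for m :: nat
  proof (cases "m = 0")
    case False
    have "4 ^ m / (2 * real m) \<le> real (2 * m choose m)"
      using False by (intro central_binomial_lower_bound) simp
    then have "4 ^ m \<le> 2 * real m * real (2 * m choose m)"
      using False by (simp add: field_simps)
    then have "real (4 ^ m) \<le> real (2 * m * (2 * m choose m))" by simp
    then have "4 ^ m \<le> 2 * m * (2 * m choose m)" by (simp only: of_nat_le_iff)
    also have "\<dots> \<le> Suc (2 * m) * (2 * m choose m)" by simp
    also have "\<dots> \<le> Lcm {1..Suc (2 * m)}"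
      by (rule dvd_imp_le[OF Suc_mult_binomial_dvd_Lcm Lcm_atLeastAtMost_pos]) simp
    finally show ?thesis .
  qed simp
  show ?thesis
  proof (cases "even n")
    case False
    then obtain m where m: "n = Suc (2 * m)" using oddE by fastforce
    show ?thesis using odd[of m] by (simp add: m power_mult)
  next
    case True
    show ?thesis
    proof (cases "n = 0")
      case False
      from True obtain c where "n = 2 * c" ..
      with False obtain m where m: "n = Suc (Suc (2 * m))" by (cases c) auto
      have "4 ^ m \<le> Lcm {1..Suc (2 * m)}" by (rule odd)
      also have "\<dots> \<le> Lcm {1..n}"
        by (intro dvd_imp_le Lcm_subset Lcm_atLeastAtMost_pos) (auto simp: m)
      finally show ?thesis by (simp add: m power_mult)
    qed simp
  qed
qed

text \<open>The product of the largest powers \<open>p ^ e p \<le> n\<close>, one for each prime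
  \<open>p \<le> n\<close>, is a common multiple of \<open>{1..n}\<close>, and each of its factors
  is at most \<open>n\<close>.\<close>

lemma Lcm_le_power_card_primes:
  fixes n :: nat
  assumes "n > 0"
  shows "Lcm {1..n} \<le> n ^ card {p. prime p \<and> p \<le> n}"
proof -
  define A where "A = {p. prime p \<and> p \<le> n}"
  have fin: "finite A" by (simp add: A_def)
  define e where "e p = Max {i. p ^ i \<le> n}" for p
  have fin_e: "finite {i. p ^ i \<le> n}" if "p \<in> A" for p
  proof (rule finite_subset)
    have p: "p > 1" using that prime_gt_1_nat by (auto simp: A_def)
    have "i \<le> n" if "p ^ i \<le> n" for i
      using less_exp[of i] power_mono[of 2 p i] p that by linarith
    then show "{i. p ^ i \<le> n} \<subseteq> {..n}" by auto
  qed simp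
  have e_le: "p ^ e p \<le> n" if "p \<in> A" for p
  proof -
    have "e p \<in> {i. p ^ i \<le> n}"
      unfolding e_def using fin_e[OF that] assms by (intro Max_in) (auto intro: exI[of _ 0])
    then show ?thesis by simp
  qed
  define P where "P = (\<Prod>p\<in>A. p ^ e p)"
  have P_pos: "P > 0"
    unfolding P_def by (intro prod_pos) (auto simp: A_def prime_gt_0_nat)
  have "Lcm {1..n} dvd P"
  proof (rule Lcm_least)
    fix i assume i: "i \<in> {1..n}"
    show "i dvd P"
    proof (rule multiplicity_le_imp_dvd)
      fix p :: nat assume p: "prime p"
      show "multiplicity p i \<le> multiplicity p P"
      proof (cases "p \<in> A")
        case True
        have "p ^ multiplicity p i \<le> i"
          using i by (intro dvd_imp_le multiplicity_dvd) auto
        then have "multiplicity p i \<le> e p"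
          unfolding e_def using fin_e[OF True] i by (intro Max_ge) auto
        also have "e p = multiplicity p P"
          using fin True p unfolding P_def
          by (subst multiplicity_prod_prime_powers) (auto simp: A_def)
        finally show ?thesis .
      next
        case False
        then have "\<not> p dvd i" using i p by (auto simp: A_def dest!: dvd_imp_le)
        then show ?thesis by (simp add: not_dvd_imp_multiplicity_0)
      qed
    qed (use i in auto)
  qed
  then have "Lcm {1..n} \<le> P" using P_pos by (rule dvd_imp_le)
  also have "P \<le> (\<Prod>p\<in>A. n)"
    unfolding P_def by (intro prod_mono) (auto simp: e_le)
  finally show ?thesis by (simp add: A_def)
qed

text \<open>Logarithms of \<open>2 ^ n \<le> 4 * n ^ \<pi>(n)\<close>; the \<open>- 2\<close> comes
  from the factor 4.\<close>

lemma card_primes_lower_bound: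
  fixes n :: nat
  assumes "n > 0"
  shows "(real n - 2) * ln 2 \<le> real (card {p. prime p \<and> p \<le> n}) * ln (real n)"
proof -
  have "2 ^ n \<le> 4 * n ^ card {p. prime p \<and> p \<le> n}"
    using two_power_le_Lcm[of n] Lcm_le_power_card_primes[OF assms] by linarith
  then have "real (2 ^ n) \<le> real (4 * n ^ card {p. prime p \<and> p \<le> n})"
    by (simp only: of_nat_le_iff)
  then have "ln (2 ^ n) \<le> ln (4 * real n ^ card {p. prime p \<and> p \<le> n})"
    using assms by (subst ln_le_cancel_iff) auto
  moreover have "ln (4::real) = 2 * ln 2"
    using ln_realpow[of 2 2] by simp
  ultimately show ?thesis
    using assms by (simp add: ln_mult ln_realpow algebra_simps)
qed

subsection \<open>Periodic points and the number of cycles\<close>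

lemma cyclic_on_image_eq:
  assumes "cyclic_on f D"
  shows "f ` D = D"
proof
  show "f ` D \<subseteq> D" using assms by (auto intro: cyclic_on_inI)
  from assms obtain s where s: "s \<in> D" "D = orbit f s" by (auto simp: cyclic_on_def)
  show "D \<subseteq> f ` D"
  proof
    fix x assume "x \<in> D"
    then have "x \<in> orbit f s" using s by simp
    then show "x \<in> f ` D" by cases (use s in auto)
  qed
qed

lemma cyclic_on_eq_if_meet:
  assumes "cyclic_on f D" "cyclic_on f D'" "x \<in> D" "x \<in> D'"
  shows "D = D'"
  using assms orbit_cyclic_eq3 by metis

text \<open>Every union of cycles is mapped onto itself, and different collections have different
  unions, as cycles are nonempty and pairwise disjoint. Invariant sets replace \<open>2 ^ c\<close>
  because they are easy to count on average.\<close>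

lemma two_power_card_cycles_le:
  assumes "finite C"
  shows "2 ^ card {D. D \<subseteq> C \<and> cyclic_on f D} \<le> card {D. D \<subseteq> C \<and> f ` D = D}"
proof -
  let ?S = "{D. D \<subseteq> C \<and> cyclic_on f D}"
  have fin: "finite ?S" using assms by simp
  have meet: "D \<in> X" if "X \<subseteq> ?S" "D \<in> ?S" "D \<subseteq> \<Union>X" for X D
  proof -
    from that obtain x where "x \<in> D" by (auto simp: cyclic_on_def)
    with that obtain E where "E \<in> X" "x \<in> E" by auto
    with that \<open>x \<in> D\<close> have "E = D"
      by (intro cyclic_on_eq_if_meet[of f E D x]) auto
    with \<open>E \<in> X\<close> show ?thesis by simp
  qed
  have sub: "X \<subseteq> Y" if "X \<in> Pow ?S" "Y \<in> Pow ?S" "\<Union>X = \<Union>Y" for X Y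
  proof
    fix D assume "D \<in> X"
    then have "D \<subseteq> \<Union>Y" using that(3) by (metis Union_upper)
    moreover have "D \<in> ?S" using that(1) \<open>D \<in> X\<close> unfolding Pow_iff by (rule subsetD)
    ultimately show "D \<in> Y" using that(2) meet[of Y D] unfolding Pow_iff by simp
  qed
  have "inj_on Union (Pow ?S)"
    by (rule inj_onI, rule subset_antisym) (rule sub; simp)+
  then have "card (Union ` Pow ?S) = 2 ^ card ?S"
    using fin by (simp add: card_image card_Pow)
  moreover have "Union ` Pow ?S \<subseteq> {D. D \<subseteq> C \<and> f ` D = D}"
  proof (rule image_subsetI)
    fix X assume X: "X \<in> Pow ?S"
    have "f ` \<Union>X = (\<Union>D\<in>X. f ` D)" by (rule image_Union)
    also have "\<dots> = (\<Union>D\<in>X. D)"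
      using X by (intro SUP_cong refl cyclic_on_image_eq) auto
    finally show "\<Union>X \<in> {D. D \<subseteq> C \<and> f ` D = D}" using X by auto
  qed
  ultimately show ?thesis
    using card_mono[of "{D. D \<subseteq> C \<and> f ` D = D}" "Union ` Pow ?S"] assms by simp
qed

text \<open>A permutation that preserves \<open>D\<close> is determined by the permutations it
  induces on \<open>D\<close> and on \<open>C - D\<close>.\<close>

lemma card_permutations_preserving_le:
  assumes "finite C" "D \<subseteq> C"
  shows "card {\<tau>. \<tau> permutes C \<and> \<tau> ` D = D} \<le> fact (card D) * fact (card C - card D)"
proof -
  let ?P = "{\<tau>. \<tau> permutes C \<and> \<tau> ` D = D}"
  let ?r = "\<lambda>\<tau>. (perm_restrict \<tau> D, perm_restrict \<tau> (C - D))"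
  have perm: "perm_restrict \<tau> E permutes E" if "\<tau> permutes C" "\<tau> ` E = E" "E \<subseteq> C" for \<tau> E
  proof (rule bij_imp_permutes)
    have "bij_betw \<tau> E E"
      using that permutes_inj[OF that(1)] by (auto simp: bij_betw_def intro: inj_on_subset)
    then show "bij_betw (perm_restrict \<tau> E) E E"
      by (subst bij_betw_cong[where g = \<tau>]) (auto simp: perm_restrict_simps)
  qed (auto simp: perm_restrict_simps)
  have "inj_on ?r ?P"
  proof (rule inj_onI, rule ext)
    fix \<tau> \<tau>' x assume *: "\<tau> \<in> ?P" "\<tau>' \<in> ?P" "?r \<tau> = ?r \<tau>'"
    have "perm_restrict \<tau> D x = perm_restrict \<tau>' D x"
      "perm_restrict \<tau> (C - D) x = perm_restrict \<tau>' (C - D) x"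
      using *(3) by simp_all
    moreover have "\<tau> x = \<tau>' x" if "x \<notin> C"
      using * permutes_not_in[OF _ that, of \<tau>] permutes_not_in[OF _ that, of \<tau>'] by simp
    ultimately show "\<tau> x = \<tau>' x"
      by (auto simp: perm_restrict_def split: if_splits)
  qed
  moreover have "?r ` ?P \<subseteq> {\<tau>. \<tau> permutes D} \<times> {\<tau>. \<tau> permutes (C - D)}"
  proof safe
    fix \<tau> assume \<tau>: "\<tau> permutes C" "\<tau> ` D = D"
    have "\<tau> ` (C - D) = C - D"
      using \<tau> by (metis image_set_diff permutes_image permutes_inj)
    then show "perm_restrict \<tau> D permutes D" "perm_restrict \<tau> (C - D) permutes (C - D)"
      using perm \<tau> assms by auto
  qed
  moreover have "finite ({\<tau>. \<tau> permutes D} \<times> {\<tau>. \<tau> permutes (C - D)})"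
    using assms by (intro finite_cartesian_product finite_permutations) (auto intro: finite_subset)
  ultimately have "card ?P \<le> card ({\<tau>. \<tau> permutes D} \<times> {\<tau>. \<tau> permutes (C - D)})"
    by (rule card_inj_on_le)
  then show ?thesis
    using assms by (simp add: card_cartesian_product card_permutations card_Diff_subset finite_subset)
qed

text \<open>After exchanging the sums, the \<open>?z choose j\<close> sets of size \<open>j\<close>
  contribute at most \<open>fact j * fact (?z - j)\<close> each, hence \<open>fact ?z\<close>
  together, and there are \<open>?z + 1\<close> possible sizes.\<close>

lemma sum_card_preserved_subsets_le:
  assumes "finite C"
  shows "(\<Sum>\<tau> | \<tau> permutes C. card {D. D \<subseteq> C \<and> \<tau> ` D = D}) \<le> (card C + 1) * fact (card C)"
proof -
  let ?z = "card C"
  have "(\<Sum>\<tau> | \<tau> permutes C. card {D. D \<subseteq> C \<and> \<tau> ` D = D}) =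
      (\<Sum>\<tau> | \<tau> permutes C. \<Sum>D\<in>Pow C. if \<tau> ` D = D then 1 else 0)"
    using assms by (intro sum.cong refl) (auto simp: sum.If_cases intro!: arg_cong[of _ _ card])
  also have "\<dots> = (\<Sum>D\<in>Pow C. \<Sum>\<tau> | \<tau> permutes C. if \<tau> ` D = D then 1 else 0)"
    by (rule sum.swap)
  also have "\<dots> = (\<Sum>D\<in>Pow C. card {\<tau>. \<tau> permutes C \<and> \<tau> ` D = D})"
    using finite_permutations[OF assms]
    by (intro sum.cong refl) (auto simp: sum.If_cases intro!: arg_cong[of _ _ card])
  also have "\<dots> \<le> (\<Sum>D\<in>Pow C. fact (card D) * fact (?z - card D))"
    using assms by (intro sum_mono card_permutations_preserving_le) auto
  also have "\<dots> = (\<Sum>j\<in>{..?z}. \<Sum>D\<in>{D \<in> Pow C. card D = j}. fact (card D) * fact (?z - card D))"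
    using assms by (intro sum.group[symmetric]) (auto intro: card_mono)
  also have "\<dots> = (\<Sum>j\<in>{..?z}. fact ?z)"
  proof (intro sum.cong refl)
    fix j assume j: "j \<in> {..?z}"
    have "(\<Sum>D\<in>{D \<in> Pow C. card D = j}. fact (card D) * fact (?z - card D)) =
        (?z choose j) * (fact j * fact (?z - j) :: nat)"
      using n_subsets[OF assms, of j] by simp
    also have "\<dots> = fact ?z"
      using binomial_fact_lemma[of j ?z] j by (simp add: mult_ac)
    finally show "(\<Sum>D\<in>{D \<in> Pow C. card D = j}. fact (card D) * fact (?z - card D)) = (fact ?z :: nat)" .
  qed
  finally show ?thesis by simp
qed

text \<open>As a union of all sets mapped onto themselves this is the largest such subset of
  \<open>{1..n}\<close>, so inclusions follow from maximality without iterating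
  \<open>f\<close>.\<close>

definition periodic_points :: "nat \<Rightarrow> (nat \<Rightarrow> nat) \<Rightarrow> nat set" where
  "periodic_points n f = \<Union>{D. D \<subseteq> {1..n} \<and> f ` D = D}"

lemma periodic_points_subset: "periodic_points n f \<subseteq> {1..n}"
  by (auto simp: periodic_points_def)

lemma finite_periodic_points [simp]: "finite (periodic_points n f)"
  using periodic_points_subset by (rule finite_subset) simp

lemma card_periodic_points_le: "card (periodic_points n f) \<le> n"
  using card_mono[OF _ periodic_points_subset, of n f] by simp

lemma periodic_points_upper: "D \<subseteq> {1..n} \<Longrightarrow> f ` D = D \<Longrightarrow> D \<subseteq> periodic_points n f"
  by (auto simp: periodic_points_def)

lemma image_periodic_points: "f ` periodic_points n f = periodic_points n f"
proof -
  have "f ` periodic_points n f = \<Union>((`) f ` {D. D \<subseteq> {1..n} \<and> f ` D = D})"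
    unfolding periodic_points_def by (rule image_Union)
  also have "(`) f ` {D. D \<subseteq> {1..n} \<and> f ` D = D} = {D. D \<subseteq> {1..n} \<and> f ` D = D}"
    by (auto simp: image_iff)
  finally show ?thesis by (simp add: periodic_points_def)
qed

text \<open>A surjection of a finite set onto itself is injective.\<close>

lemma perm_restrict_periodic_points:
  "perm_restrict f (periodic_points n f) permutes periodic_points n f"
proof (rule bij_imp_permutes)
  have "bij_betw f (periodic_points n f) (periodic_points n f)"
    using image_periodic_points[of f n] by (simp add: bij_betw_def eq_card_imp_inj_on)
  then show "bij_betw (perm_restrict f (periodic_points n f)) (periodic_points n f) (periodic_points n f)"
    by (subst bij_betw_cong[where g = f]) (auto simp: perm_restrict_simps)
qed (auto simp: perm_restrict_simps)

text \<open>Maximality gives both inclusions. \<open>\<sigma>\<close> preserves the old set, so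
  \<open>f \<circ> \<sigma>\<close> maps it onto itself. The new set contains the old one, so
  \<open>\<sigma>\<close> permutes it as well, and then \<open>f\<close> alone maps it onto
  itself.\<close>

lemma periodic_points_comp:
  assumes "\<sigma> permutes periodic_points n f"
  shows "periodic_points n (f \<circ> \<sigma>) = periodic_points n f"
proof
  show sub: "periodic_points n f \<subseteq> periodic_points n (f \<circ> \<sigma>)"
  proof (rule periodic_points_upper)
    show "(f \<circ> \<sigma>) ` periodic_points n f = periodic_points n f"
      using permutes_image[OF assms] image_periodic_points[of f n] by (metis image_comp)
  qed (rule periodic_points_subset)
  show "periodic_points n (f \<circ> \<sigma>) \<subseteq> periodic_points n f"
  proof (rule periodic_points_upper)
    let ?D = "periodic_points n (f \<circ> \<sigma>)"
    have "\<sigma> ` ?D = ?D" using permutes_image[OF permutes_subset[OF assms sub]] .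
    then show "f ` ?D = ?D"
      using image_periodic_points[of "f \<circ> \<sigma>" n] by (metis image_comp)
  qed (rule periodic_points_subset)
qed

lemma cycles_periodic_points:
  "cycles n f = {D. D \<subseteq> periodic_points n f \<and> cyclic_on f D}"
  using periodic_points_subset[of n f] periodic_points_upper[OF _ cyclic_on_image_eq, of _ n f]
  unfolding cycles_def by blast

section \<open>Averaging over permutations of the periodic points\<close>

lemma finite_zero_k_mappings [simp]: "finite (zero_k_mappings k n)"
  by (rule finite_subset[of _ "{1..n} \<rightarrow>\<^sub>E {1..n}"]) (auto simp: zero_k_mappings_def intro: finite_PiE)

text \<open>Precomposing with a permutation moves the fibres without changing their sizes.\<close>

lemma zero_k_mappings_comp_permutation:
  assumes f: "f \<in> zero_k_mappings k n" and \<sigma>: "\<sigma> permutes {1..n}"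
  shows "f \<circ> \<sigma> \<in> zero_k_mappings k n"
proof -
  have "f \<circ> \<sigma> \<in> {1..n} \<rightarrow>\<^sub>E {1..n}"
  proof (rule PiE_I)
    fix x assume "x \<in> {1..n}"
    then have "\<sigma> x \<in> {1..n}" using permutes_in_image[OF \<sigma>] by blast
    then show "(f \<circ> \<sigma>) x \<in> {1..n}" using f by (auto simp: zero_k_mappings_def simp del: atLeastAtMost_iff)
  next
    fix x assume "x \<notin> {1..n}"
    then show "(f \<circ> \<sigma>) x = undefined"
      using f permutes_not_in[OF \<sigma>] by (auto simp: zero_k_mappings_def simp del: atLeastAtMost_iff)
  qed
  moreover have "card {x \<in> {1..n}. (f \<circ> \<sigma>) x = y} = card {x \<in> {1..n}. f x = y}" for y
  proof (rule bij_betw_same_card[of \<sigma>])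
    show "bij_betw \<sigma> {x \<in> {1..n}. (f \<circ> \<sigma>) x = y} {x \<in> {1..n}. f x = y}"
    proof (rule bij_betw_imageI)
      show "\<sigma> ` {x \<in> {1..n}. (f \<circ> \<sigma>) x = y} = {x \<in> {1..n}. f x = y}"
      proof safe
        fix x assume "x \<in> {1..n}"
        then have 1: "inv \<sigma> x \<in> {1..n}"
          using permutes_in_image[OF permutes_inv[OF \<sigma>]] by blast
        have 2: "\<sigma> (inv \<sigma> x) = x" using \<sigma> by (rule permutes_inverses)
        show "x \<in> \<sigma> ` {x' \<in> {1..n}. (f \<circ> \<sigma>) x' = f x}"
          by (rule image_eqI[of _ _ "inv \<sigma> x"]) (use 1 2 in simp_all)
      qed (use permutes_in_image[OF \<sigma>] in auto)
    qed (use permutes_inj_on[OF \<sigma>] in auto)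
  qed
  ultimately show ?thesis
    using f by (simp only: zero_k_mappings_def mem_Collect_eq simp_thms) blast
qed

text \<open>
  Permuting the values of \<open>f\<close> on its periodic points stays inside the \<open>{0,k}\<close>-mappings, so given
  the set \<open>C\<close> of periodic points and the values outside \<open>C\<close>, the restriction to \<open>C\<close> is a uniformly
  random permutation of \<open>C\<close>.
\<close>

lemma sum_zero_k_mappings_average:
  fixes H :: "nat set \<Rightarrow> (nat \<Rightarrow> nat) \<Rightarrow> real"
  assumes cong: "\<And>C f g. (\<And>x. x \<in> C \<Longrightarrow> f x = g x) \<Longrightarrow> H C f = H C g"
  shows "(\<Sum>f\<in>zero_k_mappings k n. H (periodic_points n f) f) =
    (\<Sum>f\<in>zero_k_mappings k n.
      (\<Sum>\<tau> | \<tau> permutes periodic_points n f. H (periodic_points n f) \<tau>) / fact (card (periodic_points n f)))"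
proof -
  let ?F = "zero_k_mappings k n" and ?C = "periodic_points n"
  let ?S = "Sigma ?F (\<lambda>f. {\<sigma>. \<sigma> permutes ?C f})"
  have perm_card: "card {\<sigma>. \<sigma> permutes ?C f} = fact (card (?C f))" for f
    by (simp add: card_permutations)
  \<comment> \<open>The map from \<open>(f, \<sigma>)\<close> to
    \<open>(f \<circ> \<sigma>, inv \<sigma>)\<close> is an involution of \<open>?S\<close>, because
    the periodic set does not change; it reindexes the double sum below.\<close>
  have inv_rel: "(f \<circ> \<sigma>, inv \<sigma>) \<in> ?S" if "(f, \<sigma>) \<in> ?S" for f \<sigma>
    using that by (auto simp: periodic_points_comp permutes_inv
      intro!: zero_k_mappings_comp_permutation permutes_subset[OF _ periodic_points_subset])
  have "(\<Sum>f\<in>?F. H (?C f) f) = (\<Sum>f\<in>?F. \<Sum>\<sigma> | \<sigma> permutes ?C f. H (?C f) f / fact (card (?C f)))"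
    by (simp add: perm_card)
  also have "\<dots> = (\<Sum>(f, \<sigma>)\<in>?S. H (?C f) f / fact (card (?C f)))"
    by (subst sum.Sigma) (auto intro: finite_permutations)
  also have "\<dots> = (\<Sum>(f, \<sigma>)\<in>?S. H (?C f) (f \<circ> \<sigma>) / fact (card (?C f)))"
    by (rule sum.reindex_bij_witness[of _ "\<lambda>(f, \<sigma>). (f \<circ> \<sigma>, inv \<sigma>)" "\<lambda>(f, \<sigma>). (f \<circ> \<sigma>, inv \<sigma>)"])
      (use inv_rel in \<open>auto simp: comp_assoc permutes_inv_o permutes_inv_inv periodic_points_comp\<close>)
  also have "\<dots> = (\<Sum>f\<in>?F. \<Sum>\<sigma> | \<sigma> permutes ?C f. H (?C f) (f \<circ> \<sigma>) / fact (card (?C f)))"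
    by (subst sum.Sigma) (auto intro: finite_permutations)
  also have "\<dots> = (\<Sum>f\<in>?F. (\<Sum>\<tau> | \<tau> permutes ?C f. H (?C f) \<tau>) / fact (card (?C f)))"
  proof (intro sum.cong refl)
    fix f assume "f \<in> ?F"
    \<comment> \<open>On its periodic points \<open>f\<close> is itself a permutation, so composing
      with it on the left only reorders the sum over all permutations.\<close>
    have "(\<Sum>\<sigma> | \<sigma> permutes ?C f. H (?C f) (f \<circ> \<sigma>)) =
        (\<Sum>\<sigma> | \<sigma> permutes ?C f. H (?C f) (perm_restrict f (?C f) \<circ> \<sigma>))"
      by (intro sum.cong refl cong) (auto simp: perm_restrict_def permutes_in_image)
    also have "\<dots> = (\<Sum>\<tau> | \<tau> permutes ?C f. H (?C f) \<tau>)"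
      by (rule setum_permutations_compose_left[symmetric]) (rule perm_restrict_periodic_points)
    finally show "(\<Sum>\<sigma> | \<sigma> permutes ?C f. H (?C f) (f \<circ> \<sigma>) / fact (card (?C f))) =
        (\<Sum>\<tau> | \<tau> permutes ?C f. H (?C f) \<tau>) / fact (card (?C f))"
      by (simp flip: sum_divide_distrib)
  qed
  finally show ?thesis .
qed

text \<open>The averaging identity is applied to the number of invariant subsets of the periodic
  set, whose mean over the permutations of a set of size \<open>m\<close> is at most
  \<open>m + 1\<close>.\<close>

lemma sum_two_power_card_cycles_le:
  "(\<Sum>f\<in>zero_k_mappings k n. 2 ^ card (cycles n f)) \<le> (real n + 1) * card (zero_k_mappings k n)"
proof -
  let ?F = "zero_k_mappings k n" and ?C = "periodic_points n"
  let ?H = "\<lambda>C f :: nat \<Rightarrow> nat. real (card {D. D \<subseteq> C \<and> f ` D = D})"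
  have "(\<Sum>f\<in>?F. 2 ^ card (cycles n f)) \<le> (\<Sum>f\<in>?F. ?H (?C f) f)"
  proof (rule sum_mono)
    fix f
    have "2 ^ card (cycles n f) \<le> card {D. D \<subseteq> ?C f \<and> f ` D = D}"
      unfolding cycles_periodic_points by (rule two_power_card_cycles_le) simp
    then show "2 ^ card (cycles n f) \<le> ?H (?C f) f"
      using of_nat_mono by fastforce
  qed
  also have "\<dots> = (\<Sum>f\<in>?F. (\<Sum>\<tau> | \<tau> permutes ?C f. ?H (?C f) \<tau>) / fact (card (?C f)))"
  proof (rule sum_zero_k_mappings_average)
    fix C and f g :: "nat \<Rightarrow> nat" assume "\<And>x. x \<in> C \<Longrightarrow> f x = g x"
    then have "f ` D = g ` D" if "D \<subseteq> C" for D using that by (intro image_cong) auto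
    then show "?H C f = ?H C g" by (metis (no_types, lifting))
  qed
  also have "\<dots> \<le> (\<Sum>f\<in>?F. real n + 1)"
  proof (rule sum_mono)
    fix f
    have "(\<Sum>\<tau> | \<tau> permutes ?C f. ?H (?C f) \<tau>) \<le> real ((card (?C f) + 1) * fact (card (?C f)))"
      using sum_card_preserved_subsets_le[of "?C f"] by (subst of_nat_sum[symmetric], subst of_nat_le_iff) simp
    then have "(\<Sum>\<tau> | \<tau> permutes ?C f. ?H (?C f) \<tau>) / fact (card (?C f)) \<le> real (card (?C f)) + 1"
      by (simp add: divide_le_eq algebra_simps)
    also have "\<dots> \<le> real n + 1" using card_periodic_points_le[of n f] by simp
    finally show "(\<Sum>\<tau> | \<tau> permutes ?C f. ?H (?C f) \<tau>) / fact (card (?C f)) \<le> real n + 1" .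
  qed
  finally show ?thesis by (simp add: mult.commute)
qed

section \<open>Markov's inequality for the tail of \<open>T_lcm\<close>\<close>

lemma T_lcm_le:
  assumes "n > 0"
  shows "T_lcm n f \<le> n ^ card (cycles n f)"
proof -
  have fin: "finite (cycles n f)" by (simp add: cycles_def)
  have card: "card D > 0 \<and> card D \<le> n" if "D \<in> cycles n f" for D
    using that card_mono[of "{1..n}" D]
    by (auto simp: cycles_def card_gt_0_iff cyclic_on_def intro: finite_subset)
  have "T_lcm n f dvd (\<Prod>D\<in>cycles n f. card D)"
    unfolding T_lcm_def using fin by (intro Lcm_least) (auto intro: dvd_prodI)
  then have "T_lcm n f \<le> (\<Prod>D\<in>cycles n f. card D)"
    using card by (intro dvd_imp_le prod_pos) auto
  also have "\<dots> \<le> (\<Prod>D\<in>cycles n f. n)" using card by (intro prod_mono) auto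
  finally show ?thesis by simp
qed

text \<open>Since \<open>T_lcm n f \<le> n ^ c\<close>, reaching \<open>\<xi>\<close> forces
  \<open>c \<ge> ln \<xi> / ln n\<close>. Markov's inequality is then applied to
  \<open>2 ^ c\<close>.\<close>

lemma card_T_lcm_ge_le:
  fixes \<xi> :: real
  assumes n: "n > 1" and \<xi>: "\<xi> > 0"
  shows "real (card {f \<in> zero_k_mappings k n. \<xi> \<le> real (T_lcm n f)})
    \<le> (real n + 1) * exp (- (ln 2 * ln \<xi> / ln (real n))) * card (zero_k_mappings k n)"
proof -
  let ?F = "zero_k_mappings k n" and ?e = "exp (ln 2 * ln \<xi> / ln (real n))"
  let ?A = "{f \<in> ?F. \<xi> \<le> real (T_lcm n f)}"
  have "?e \<le> 2 ^ card (cycles n f)" if "f \<in> ?A" for f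
  proof -
    let ?c = "card (cycles n f)"
    have "\<xi> \<le> real (n ^ ?c)"
      using that T_lcm_le[of n f] n by (auto intro: order_trans simp del: of_nat_power)
    then have "ln \<xi> \<le> ln (real n ^ ?c)" using \<xi> n by (subst ln_le_cancel_iff) auto
    then have "ln \<xi> \<le> ?c * ln n" using n by (simp add: ln_realpow)
    then have "ln 2 * ln \<xi> / ln n \<le> ?c * ln 2" using n by (simp add: field_simps)
    then have "?e \<le> exp (?c * ln 2)" by simp
    then show ?thesis by (simp add: exp_of_nat_mult)
  qed
  then have "card ?A * ?e \<le> (\<Sum>f\<in>?A. 2 ^ card (cycles n f))"
    by (intro sum_bounded_below) simp
  also have "\<dots> \<le> (\<Sum>f\<in>?F. 2 ^ card (cycles n f))" by (intro sum_mono2) auto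
  also have "\<dots> \<le> (real n + 1) * card ?F" by (rule sum_two_power_card_cycles_le)
  finally have "card ?A \<le> (real n + 1) * card ?F / ?e"
    by (simp add: pos_le_divide_eq)
  then show ?thesis by (simp add: exp_minus divide_inverse mult_ac)
qed

subsection \<open>Permutations with prescribed cycle lengths\<close>

text \<open>Precomposing with the transposition of \<open>a\<close> and \<open>b\<close> inserts
  \<open>a\<close> into the cycle directly after \<open>b\<close>: the new map sends
  \<open>b\<close> to \<open>a\<close> and \<open>a\<close> to \<open>\<delta> b\<close>.\<close>

lemma cyclic_on_comp_transpose:
  assumes \<delta>: "cyclic_on \<delta> D" "\<delta> a = a" and a: "a \<notin> D" and b: "b \<in> D"
  shows "cyclic_on (\<delta> \<circ> Transposition.transpose a b) (insert a D)"
proof -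
  let ?\<delta> = "\<delta> \<circ> Transposition.transpose a b"
  have vals: "?\<delta> a = \<delta> b" "?\<delta> b = a" "\<And>x. x \<noteq> a \<Longrightarrow> x \<noteq> b \<Longrightarrow> ?\<delta> x = \<delta> x"
    using \<delta>(2) by simp_all
  have \<delta>b: "\<delta> b \<in> D" using \<delta>(1) b by (rule cyclic_on_inI)
  have base: "\<delta> b \<in> orbit ?\<delta> a"
    using orbit.base[of ?\<delta> a] by (simp only: vals)
  \<comment> \<open>On \<open>D\<close> the old and the new map differ only at \<open>b\<close>, and
    the old successor \<open>\<delta> b\<close> is already known to lie in the new orbit.\<close>
  have "x \<in> orbit ?\<delta> a" if "x \<in> orbit \<delta> (\<delta> b)" for x
    using that
  proof induction
    case base
    show ?case
    proof (cases "\<delta> b = b")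
      case False
      then show ?thesis
        using orbit.step[OF \<open>\<delta> b \<in> orbit ?\<delta> a\<close>] vals(3)[of "\<delta> b"] \<delta>b a by metis
    qed (use \<open>\<delta> b \<in> orbit ?\<delta> a\<close> in \<open>simp only:\<close>)
  next
    case (step y)
    then have "y \<noteq> a" using a orbit_cyclic_eq3[OF \<delta>(1) \<delta>b] by auto
    then show ?case
      using orbit.step[OF step.IH] vals(3)[of y] \<open>\<delta> b \<in> orbit ?\<delta> a\<close> by metis
  qed
  then have D: "D \<subseteq> orbit ?\<delta> a"
    using orbit_cyclic_eq3[OF \<delta>(1) \<delta>b] by auto
  then have "a \<in> orbit ?\<delta> a"
    using b orbit.step[of b ?\<delta> a] vals(2) by auto
  moreover have "orbit ?\<delta> a \<subseteq> insert a D"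
  proof
    fix x assume "x \<in> orbit ?\<delta> a"
    then show "x \<in> insert a D"
    proof induction
      case base
      show ?case using \<delta>b by (simp only: vals) simp
    next
      case (step y)
      then show ?case
        using \<delta>b vals cyclic_on_inI[OF \<delta>(1), of y] by (metis insert_iff)
    qed
  qed
  ultimately have "insert a D = orbit ?\<delta> a" using D by auto
  then show ?thesis by (intro cyclic_on_singleI[of a]) auto
qed

text \<open>A new point \<open>a\<close> can be inserted after any \<open>b \<in> D\<close>, which
  multiplies the count by \<open>card D\<close>. The choice is recovered from the result, as
  \<open>b\<close> is the preimage of \<open>a\<close>.\<close>

lemma card_cyclic_permutations_ge:
  assumes "finite D" "D \<noteq> {}"
  shows "fact (card D - 1) \<le> card {\<delta>. \<delta> permutes D \<and> cyclic_on \<delta> D}"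
  using assms
proof (induction rule: finite_ne_induct)
  case (singleton x)
  have "cyclic_on id {x}"
    by (rule cyclic_on_singleI[of x]) (simp_all add: orbit_eq_singleton_iff[THEN iffD2])
  then have "{\<delta>. \<delta> permutes {x} \<and> cyclic_on \<delta> {x}} = {id}"
    by auto
  then show ?case by simp
next
  case (insert a D)
  let ?X = "\<lambda>D. {\<delta>. \<delta> permutes D \<and> cyclic_on \<delta> D}"
  let ?g = "\<lambda>(b, \<delta>). \<delta> \<circ> Transposition.transpose a b"
  have fin: "finite (?X E)" if "finite E" for E :: "'a set"
    using finite_permutations[OF that] by (rule rev_finite_subset) auto
  have "inj_on ?g (D \<times> ?X D)"
  proof (rule inj_onI, clarify)
    fix b b' \<delta> \<delta>' assume *: "b \<in> D" "b' \<in> D" "\<delta> permutes D" "\<delta>' permutes D"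
      "\<delta> \<circ> Transposition.transpose a b = \<delta>' \<circ> Transposition.transpose a b'"
    have a: "\<delta> a = a" "\<delta>' a = a" using * insert.hyps by (auto simp: permutes_not_in)
    have "\<delta>' (Transposition.transpose a b' b) = \<delta> (Transposition.transpose a b b)"
      using fun_cong[OF *(5), of b] by simp
    also have "\<dots> = \<delta>' a" using a by simp
    finally have "Transposition.transpose a b' b = a"
      using permutes_inj[OF *(4)] by (simp add: inj_eq)
    then have b: "b = b'" by (metis transpose_apply_first transpose_involutory)
    moreover have "\<delta> = \<delta> \<circ> Transposition.transpose a b \<circ> Transposition.transpose a b" by (simp add: comp_assoc)
    moreover have "\<delta>' = \<delta>' \<circ> Transposition.transpose a b' \<circ> Transposition.transpose a b'" by (simp add: comp_assoc)
    ultimately show "b = b' \<and> \<delta> = \<delta>'" using *(5) by metis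
  qed
  moreover have "?g ` (D \<times> ?X D) \<subseteq> ?X (insert a D)"
  proof clarify
    fix b \<delta> assume *: "b \<in> D" "\<delta> permutes D" "cyclic_on \<delta> D"
    have "\<delta> \<circ> Transposition.transpose a b permutes insert a D"
      using * by (intro permutes_compose permutes_swap_id permutes_subset[OF *(2)]) auto
    moreover have "cyclic_on (\<delta> \<circ> Transposition.transpose a b) (insert a D)"
      using * insert.hyps by (intro cyclic_on_comp_transpose) (auto simp: permutes_not_in)
    ultimately show "\<delta> \<circ> Transposition.transpose a b permutes insert a D \<and> cyclic_on (\<delta> \<circ> Transposition.transpose a b) (insert a D)"
      by blast
  qed
  ultimately have "card (D \<times> ?X D) \<le> card (?X (insert a D))"
    using insert.hyps by (intro card_inj_on_le fin) auto
  moreover have "fact (card D) \<le> card D * card (?X D)"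
    using insert by (simp add: fact_reduce[of "card D"] card_gt_0_iff)
  ultimately show ?case
    using insert.hyps by (simp add: card_cartesian_product)
qed

text \<open>A variant of \<open>cycles\<close> on an arbitrary carrier. It depends only on the
  values of \<open>\<tau>\<close> on \<open>C\<close>, as the averaging identity requires.\<close>

definition cycle_sets :: "(nat \<Rightarrow> nat) \<Rightarrow> nat set \<Rightarrow> nat set set" where
  "cycle_sets \<tau> C = {D. D \<subseteq> C \<and> cyclic_on \<tau> D}"

lemma cycle_sets_cong: "(\<And>x. x \<in> C \<Longrightarrow> f x = g x) \<Longrightarrow> cycle_sets f C = cycle_sets g C"
  unfolding cycle_sets_def by (intro Collect_cong conj_cong refl cyclic_cong) auto

lemma cycles_eq_cycle_sets: "cycles n f = cycle_sets f (periodic_points n f)"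
  by (simp add: cycles_periodic_points cycle_sets_def)

text \<open>
  The permutations of \<open>C\<close> with exactly one cycle of each length in \<open>Q\<close>, whose remaining points form a
  single cycle.
\<close>

definition perms_with_cycle_lengths :: "nat set \<Rightarrow> nat set \<Rightarrow> (nat \<Rightarrow> nat) set" where
  "perms_with_cycle_lengths C Q = {\<tau>. \<tau> permutes C \<and> inj_on card (cycle_sets \<tau> C) \<and>
     card ` cycle_sets \<tau> C = insert (card C - \<Sum>Q) Q}"

lemma finite_perms_with_cycle_lengths: "finite C \<Longrightarrow> finite (perms_with_cycle_lengths C Q)"
  unfolding perms_with_cycle_lengths_def
  using finite_permutations by (rule rev_finite_subset) auto

text \<open>The two permutations have disjoint supports, so the composite is \<open>\<delta>\<close>
  on \<open>D\<close> and \<open>\<tau>\<close> on \<open>C - D\<close>; a cycle that meets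
  \<open>D\<close> equals \<open>D\<close>.\<close>

lemma cycle_sets_comp:
  assumes "\<delta> permutes D" "cyclic_on \<delta> D" "\<tau> permutes (C - D)" "D \<subseteq> C"
  shows "cycle_sets (\<delta> \<circ> \<tau>) C = insert D (cycle_sets \<tau> (C - D))"
proof -
  have on_D: "(\<delta> \<circ> \<tau>) x = \<delta> x" if "x \<in> D" for x
    using permutes_not_in[OF assms(3)] that by simp
  have off_D: "(\<delta> \<circ> \<tau>) x = \<tau> x" if "x \<in> C - D" for x
    using permutes_not_in[OF assms(1), of "\<tau> x"] permutes_in_image[OF assms(3), of x] that by simp
  have cyc_D: "cyclic_on (\<delta> \<circ> \<tau>) D"
    using assms(2) cyclic_cong[of D "\<delta> \<circ> \<tau>" \<delta>] on_D by blast
  have cyc_off: "cyclic_on (\<delta> \<circ> \<tau>) E \<longleftrightarrow> cyclic_on \<tau> E" if "E \<subseteq> C - D" for E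
    using cyclic_cong[of E "\<delta> \<circ> \<tau>" \<tau>] off_D that by blast
  have split: "E = D \<or> E \<subseteq> C - D" if "E \<subseteq> C" "cyclic_on (\<delta> \<circ> \<tau>) E" for E
    using that cyclic_on_eq_if_meet[OF that(2) cyc_D] by blast
  show ?thesis
  proof (rule set_eqI)
    fix E
    have "E \<in> cycle_sets (\<delta> \<circ> \<tau>) C \<longleftrightarrow> E \<subseteq> C \<and> cyclic_on (\<delta> \<circ> \<tau>) E"
      by (simp only: cycle_sets_def mem_Collect_eq)
    also have "\<dots> \<longleftrightarrow> E = D \<or> E \<subseteq> C - D \<and> cyclic_on (\<delta> \<circ> \<tau>) E"
      using split[of E] cyc_D assms(4) by (metis Diff_subset order_trans)
    also have "\<dots> \<longleftrightarrow> E \<in> insert D (cycle_sets \<tau> (C - D))"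
      unfolding insert_iff cycle_sets_def mem_Collect_eq using cyc_off[of E] by argo
    finally show "E \<in> cycle_sets (\<delta> \<circ> \<tau>) C \<longleftrightarrow> E \<in> insert D (cycle_sets \<tau> (C - D))" .
  qed
qed

text \<open>Induction on \<open>Q\<close>: choose the point set \<open>D\<close> of the cycle of
  length \<open>p\<close>, a cyclic permutation of \<open>D\<close>, and a suitable permutation of
  \<open>C - D\<close>. As \<open>(z choose p) * fact (p - 1) * fact (z - p) = fact z / p\<close>,
  each element of \<open>Q\<close> costs a factor equal to itself. The number of points left for the
  last cycle is the same at every stage.\<close>

lemma card_perms_with_cycle_lengths_ge:
  assumes "finite Q" "finite C" "0 \<notin> Q" "\<Sum>Q < card C" "\<And>q. q \<in> Q \<Longrightarrow> \<Sum>Q + q < card C"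
  shows "fact (card C) / (real (card C - \<Sum>Q) * real (\<Prod>Q)) \<le> card (perms_with_cycle_lengths C Q)"
  using assms
proof (induction Q arbitrary: C rule: finite_induct)
  case empty
  then have C: "C \<noteq> {}" by auto
  have "{\<delta>. \<delta> permutes C \<and> cyclic_on \<delta> C} \<subseteq> perms_with_cycle_lengths C {}"
  proof clarify
    fix \<delta> assume *: "\<delta> permutes C" "cyclic_on \<delta> C"
    have "cycle_sets \<delta> C = {C}"
    proof -
      have "D = C" if "D \<subseteq> C" "cyclic_on \<delta> D" for D
        using that * cyclic_on_eq_if_meet[OF that(2) *(2)] by (auto simp: cyclic_on_def)
      then show ?thesis using * by (auto simp: cycle_sets_def)
    qed
    then show "\<delta> \<in> perms_with_cycle_lengths C {}"
      using * by (simp add: perms_with_cycle_lengths_def)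
  qed
  then have "card {\<delta>. \<delta> permutes C \<and> cyclic_on \<delta> C} \<le> card (perms_with_cycle_lengths C {})"
    by (intro card_mono finite_perms_with_cycle_lengths empty)
  then have "fact (card C - 1) \<le> card (perms_with_cycle_lengths C {})"
    using card_cyclic_permutations_ge[OF \<open>finite C\<close> C] by linarith
  then have "real (fact (card C - 1)) \<le> card (perms_with_cycle_lengths C {})"
    by (simp only: of_nat_le_iff)
  then show ?case
    using C empty by (simp add: fact_reduce[of "card C"] card_gt_0_iff)
next
  case (insert p Q)
  let ?z = "card C" and ?r = "card C - \<Sum>(insert p Q)" and ?P = perms_with_cycle_lengths
  let ?X = "\<lambda>D. {\<delta>. \<delta> permutes D \<and> cyclic_on \<delta> D}"
  let ?Ds = "{D. D \<subseteq> C \<and> card D = p}"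
  let ?S = "SIGMA D:?Ds. ?X D \<times> ?P (C - D) Q"
  let ?g = "\<lambda>(D, \<delta>, \<tau>). \<delta> \<circ> \<tau>"
  have p: "p > 0" using insert.prems by (auto intro: Nat.gr0I)
  have sum: "\<Sum>(insert p Q) = p + \<Sum>Q" using insert.hyps by simp
  \<comment> \<open>The last cycle is longer than \<open>p\<close>, so \<open>D\<close> is the only
    cycle of length \<open>p\<close>. This keeps the lengths distinct and lets \<open>D\<close> be
    recovered from the composite.\<close>
  have r: "?r > p" using insert.prems(4)[of p] sum by simp
  have pz: "p \<le> ?z" using insert.prems(3) sum by simp
  have card_diff: "card (C - D) = ?z - p" if "D \<in> ?Ds" for D
    using that \<open>finite C\<close> by (auto simp: card_Diff_subset finite_subset)
  have fin_X: "finite (?X D)" if "D \<subseteq> C" for D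
    using finite_permutations[OF finite_subset[OF that \<open>finite C\<close>]] by (rule rev_finite_subset) auto
  have fin_P: "finite (?P (C - D) Q)" for D
    using \<open>finite C\<close> by (intro finite_perms_with_cycle_lengths) auto
  have sets: "cycle_sets (\<delta> \<circ> \<tau>) C = insert D (cycle_sets \<tau> (C - D))"
    "card ` cycle_sets \<tau> (C - D) = insert ?r Q" "card D = p"
    "\<tau> permutes C - D" "\<delta> permutes D" "D \<subseteq> C" "inj_on card (cycle_sets \<tau> (C - D))"
    if "(D, \<delta>, \<tau>) \<in> ?S" for D \<delta> \<tau>
    using that cycle_sets_comp[of \<delta> D \<tau> C] card_diff[of D] sum
    by (auto simp: perms_with_cycle_lengths_def)
  have "?g ` ?S \<subseteq> ?P C (insert p Q)"
  proof (rule image_subsetI, clarify)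
    fix D \<delta> \<tau> assume mem: "D \<subseteq> C" "\<delta> permutes D" "cyclic_on \<delta> D" "\<tau> \<in> ?P (C - D) Q" "p = card D"
    then have "(D, \<delta>, \<tau>) \<in> ?S" by simp
    note s = sets[OF this]
    have "\<delta> \<circ> \<tau> permutes C"
      using s by (intro permutes_compose) (auto intro: permutes_subset)
    moreover have "card D \<notin> card ` cycle_sets \<tau> (C - D)"
      using s r insert.hyps by auto
    then have "inj_on card (cycle_sets (\<delta> \<circ> \<tau>) C)"
      unfolding s(1) using s(7) by (auto simp: inj_on_insert)
    moreover have "card ` cycle_sets (\<delta> \<circ> \<tau>) C = insert (card C - \<Sum>(insert (card D) Q)) (insert (card D) Q)"
      unfolding s(1) image_insert s(2) unfolding mem(5) by (rule insert_commute)
    ultimately show "\<delta> \<circ> \<tau> \<in> ?P C (insert (card D) Q)"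
      unfolding perms_with_cycle_lengths_def by blast
  qed
  moreover have "inj_on ?g ?S"
  proof (rule inj_onI)
    fix u u' assume u: "u \<in> ?S" and u': "u' \<in> ?S" and eq: "?g u = ?g u'"
    obtain D \<delta> \<tau> D' \<delta>' \<tau>' where uu: "u = (D, \<delta>, \<tau>)" "u' = (D', \<delta>', \<tau>')"
      by (cases u, cases u') auto
    note s = sets[OF u[unfolded uu]] and s' = sets[OF u'[unfolded uu]]
    have comp: "\<delta> \<circ> \<tau> = \<delta>' \<circ> \<tau>'" using eq uu by simp
    have "D' \<in> insert D (cycle_sets \<tau> (C - D))"
      using s(1) s'(1) comp by auto
    moreover have "card D' \<notin> card ` cycle_sets \<tau> (C - D)"
      using s s' r insert.hyps by auto
    ultimately have D: "D' = D" by blast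
    have "\<delta> x = \<delta>' x \<and> \<tau> x = \<tau>' x" for x
    proof (cases "x \<in> D")
      case True
      then show ?thesis
        using fun_cong[OF comp, of x] permutes_not_in[OF s(4), of x] permutes_not_in[OF s'(4), of x] D by simp
    next
      case False
      have "\<tau> x \<notin> D" "\<tau>' x \<notin> D"
        using False permutes_in_image[OF s(4), of x] permutes_not_in[OF s(4), of x]
          permutes_in_image[OF s'(4), of x] permutes_not_in[OF s'(4), of x] D s(6)
        by (metis Diff_iff)+
      then show ?thesis
        using fun_cong[OF comp, of x] False D
          permutes_not_in[OF s(5)] permutes_not_in[OF s'(5)] by simp
    qed
    then show "u = u'" using uu D by auto
  qed
  ultimately have "card ?S \<le> card (?P C (insert p Q))"
    by (intro card_inj_on_le finite_perms_with_cycle_lengths \<open>finite C\<close>)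
  have "fact ?z / (real ?r * real (\<Prod>(insert p Q))) =
      (?z choose p) * (fact (p - 1) * (fact (?z - p) / (real ?r * real (\<Prod>Q))))"
  proof -
    have "(fact ?z :: real) = (?z choose p) * (p * fact (p - 1) * fact (?z - p))"
      using binomial_fact_lemma[OF pz, THEN arg_cong[of _ _ real]] fact_reduce[OF p, where 'a = real]
      by (simp add: mult_ac)
    then show ?thesis using p insert.hyps by simp
  qed
  also have "\<dots> = (\<Sum>D\<in>?Ds. fact (p - 1) * (fact (?z - p) / (real ?r * real (\<Prod>Q))))"
    using n_subsets[OF \<open>finite C\<close>, of p] by simp
  also have "\<dots> \<le> (\<Sum>D\<in>?Ds. real (card (?X D)) * real (card (?P (C - D) Q)))"
  proof (intro sum_mono mult_mono)
    fix D assume D: "D \<in> ?Ds"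
    then have "D \<noteq> {}" "finite D" using p \<open>finite C\<close> by (auto intro: finite_subset)
    then have "fact (p - 1) \<le> card (?X D)" using card_cyclic_permutations_ge[of D] D by simp
    then have "real (fact (p - 1)) \<le> real (card (?X D))" by (simp only: of_nat_le_iff)
    then show "fact (p - 1) \<le> real (card (?X D))" by simp
    have "fact (card (C - D)) / (real (card (C - D) - \<Sum>Q) * real (\<Prod>Q)) \<le> card (?P (C - D) Q)"
    proof (rule insert.IH)
      show "\<Sum>Q < card (C - D)" using card_diff[OF D] r sum by simp
      show "\<Sum>Q + q < card (C - D)" if "q \<in> Q" for q
        using card_diff[OF D] insert.prems(4)[of q] that sum by simp
    qed (use insert.prems in auto)
    then show "fact (?z - p) / (real ?r * real (\<Prod>Q)) \<le> card (?P (C - D) Q)"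
      using card_diff[OF D] sum by simp
  qed (auto intro!: divide_nonneg_nonneg mult_nonneg_nonneg prod_nonneg)
  also have "\<dots> = real (card ?S)"
    using \<open>finite C\<close> by (subst card_SigmaI) (auto simp: card_cartesian_product fin_X fin_P)
  also have "\<dots> \<le> card (?P C (insert p Q))"
    using \<open>card ?S \<le> card (?P C (insert p Q))\<close> by simp
  finally show ?case .
qed

section \<open>Lower bounds for sums of \<open>Lcm\<close> from sets of primes\<close>

lemma prod_primes_dvd_Lcm:
  fixes Q L :: "nat set"
  assumes "finite Q" "\<And>q. q \<in> Q \<Longrightarrow> prime q" "Q \<subseteq> L"
  shows "\<Prod>Q dvd Lcm L"
  using assms
proof (induction Q rule: finite_induct)
  case (insert p Q)
  have "coprime p (\<Prod>Q)"
    using insert by (intro prod_coprime_right) (auto intro: primes_coprime)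
  then have "p * \<Prod>Q dvd Lcm L"
    using insert by (intro divides_mult) (auto intro: dvd_Lcm)
  then show ?case using insert.hyps by simp
qed simp

text \<open>For each \<open>Q \<subseteq> A\<close> the lower bound \<open>\<Prod>Q\<close> for the
  Lcm cancels the factor \<open>\<Prod>Q\<close> lost in the count, so each of the
  \<open>2 ^ card A\<close> subsets contributes at least
  \<open>fact (card C) / card C\<close>.\<close>

lemma sum_Lcm_cycle_lengths_ge:
  assumes C: "finite C" and A: "finite A" "\<And>q. q \<in> A \<Longrightarrow> prime q"
    and C_gt: "\<Sum>A < card C" "\<And>q. q \<in> A \<Longrightarrow> \<Sum>A + q < card C"
  shows "2 ^ card A * fact (card C) / real (card C)
    \<le> (\<Sum>\<tau> | \<tau> permutes C. real (Lcm (card ` cycle_sets \<tau> C)))"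
proof -
  let ?P = "perms_with_cycle_lengths C"
  have pos: "card C > 0" using C_gt(1) by simp
  have sub: "\<Sum>Q \<le> \<Sum>A" if "Q \<subseteq> A" for Q using A(1) that by (rule sum_mono2) auto
  \<comment> \<open>The last cycle is longer than every element of \<open>A\<close>, so
    \<open>Q\<close> can be read off from the cycle lengths. The families for different
    \<open>Q\<close> are therefore disjoint.\<close>
  have Q_eq: "Q = A \<inter> card ` cycle_sets \<tau> C" if "Q \<subseteq> A" "\<tau> \<in> ?P Q" for Q \<tau>
  proof -
    have "q < card C - \<Sum>Q" if "q \<in> A" for q
      using sub[OF \<open>Q \<subseteq> A\<close>] C_gt(2)[OF that] by linarith
    then show ?thesis using that by (auto simp: perms_with_cycle_lengths_def)
  qed
  have Lcm_ge: "real (\<Prod>Q) \<le> real (Lcm (card ` cycle_sets \<tau> C))" if "Q \<subseteq> A" "\<tau> \<in> ?P Q" for Q \<tau>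
  proof -
    have "finite (cycle_sets \<tau> C)" using C by (simp add: cycle_sets_def)
    moreover have "0 \<notin> card ` cycle_sets \<tau> C"
      using C by (auto simp: cycle_sets_def cyclic_on_def dest: finite_subset)
    ultimately have "Lcm (card ` cycle_sets \<tau> C) > 0"
      by (intro Nat.gr0I) (auto simp: Lcm_0_iff)
    moreover have "\<Prod>Q dvd Lcm (card ` cycle_sets \<tau> C)"
      using that A by (intro prod_primes_dvd_Lcm)
        (auto simp: perms_with_cycle_lengths_def intro: finite_subset)
    ultimately show ?thesis unfolding of_nat_le_iff by (intro dvd_imp_le)
  qed
  have "2 ^ card A * fact (card C) / real (card C) = (\<Sum>Q\<in>Pow A. fact (card C) / real (card C))"
    using A by (simp add: card_Pow)
  also have "\<dots> \<le> (\<Sum>Q\<in>Pow A. \<Sum>\<tau>\<in>?P Q. real (Lcm (card ` cycle_sets \<tau> C)))"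
  proof (rule sum_mono)
    fix Q assume Q: "Q \<in> Pow A"
    then have fin_Q: "finite Q" using A finite_subset by auto
    have prod_pos: "\<Prod>Q > 0" using Q A(2) prime_gt_0_nat by (intro prod_pos) blast
    have less: "\<Sum>Q < card C" using sub[of Q] Q C_gt(1) by simp
    have "fact (card C) / real (card C) \<le> fact (card C) / real (card C - \<Sum>Q)"
    proof (rule frac_le)
      show "0 < real (card C - \<Sum>Q)" "real (card C - \<Sum>Q) \<le> real (card C)"
        unfolding of_nat_le_iff of_nat_0_less_iff using less by simp_all
    qed simp_all
    also have "\<dots> = fact (card C) / (real (card C - \<Sum>Q) * real (\<Prod>Q)) * real (\<Prod>Q)"
      using prod_pos unfolding of_nat_0_less_iff[where 'a = real, symmetric] by (simp del: of_nat_prod)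
    also have "\<dots> \<le> card (?P Q) * real (\<Prod>Q)"
    proof (intro mult_right_mono card_perms_with_cycle_lengths_ge fin_Q C less)
      show "0 \<notin> Q" using A(2)[of 0] Q by auto
      show "\<Sum>Q + q < card C" if "q \<in> Q" for q
        using sub[of Q] Q C_gt(2)[of q] that by auto
    qed (rule of_nat_0_le_iff)
    also have "\<dots> \<le> (\<Sum>\<tau>\<in>?P Q. real (Lcm (card ` cycle_sets \<tau> C)))"
      using Q Lcm_ge by (intro sum_bounded_below) auto
    finally show "fact (card C) / real (card C) \<le> (\<Sum>\<tau>\<in>?P Q. real (Lcm (card ` cycle_sets \<tau> C)))" .
  qed
  also have "\<dots> = (\<Sum>\<tau>\<in>\<Union>(?P ` Pow A). real (Lcm (card ` cycle_sets \<tau> C)))"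
  proof (rule sum.UNION_disjoint[symmetric])
    show "\<forall>Q\<in>Pow A. \<forall>Q'\<in>Pow A. Q \<noteq> Q' \<longrightarrow> ?P Q \<inter> ?P Q' = {}"
    proof (intro ballI impI equals0I)
      fix Q Q' \<tau> assume "Q \<in> Pow A" "Q' \<in> Pow A" "Q \<noteq> Q'" "\<tau> \<in> ?P Q \<inter> ?P Q'"
      then show False using Q_eq[of Q \<tau>] Q_eq[of Q' \<tau>] by simp
    qed
  qed (use A C in \<open>auto intro: finite_perms_with_cycle_lengths\<close>)
  also have "\<dots> \<le> (\<Sum>\<tau> | \<tau> permutes C. real (Lcm (card ` cycle_sets \<tau> C)))"
    by (intro sum_mono2 finite_permutations C) (auto simp: perms_with_cycle_lengths_def)
  finally show ?thesis .
qed

text \<open>The bound for permutations is averaged over the mappings with at least \<open>z\<close>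
  periodic points; the other mappings contribute nonnegative terms.\<close>

lemma sum_T_lcm_ge:
  assumes A: "finite A" "\<And>q. q \<in> A \<Longrightarrow> prime q"
    and z: "\<Sum>A < z" "\<And>q. q \<in> A \<Longrightarrow> \<Sum>A + q < z"
  shows "2 ^ card A / real n * card {f \<in> zero_k_mappings k n. z \<le> card (periodic_points n f)}
    \<le> (\<Sum>f\<in>zero_k_mappings k n. real (T_lcm n f))"
proof -
  let ?F = "zero_k_mappings k n" and ?C = "periodic_points n"
  let ?H = "\<lambda>C f. real (Lcm (card ` cycle_sets f C))"
  have "2 ^ card A / real n * card {f \<in> ?F. z \<le> card (?C f)} =
      (\<Sum>f\<in>{f \<in> ?F. z \<le> card (?C f)}. 2 ^ card A / real n)"
    by simp
  also have "\<dots> \<le> (\<Sum>f\<in>{f \<in> ?F. z \<le> card (?C f)}. (\<Sum>\<tau> | \<tau> permutes ?C f. ?H (?C f) \<tau>) / fact (card (?C f)))"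
  proof (rule sum_mono)
    fix f assume "f \<in> {f \<in> ?F. z \<le> card (?C f)}"
    then have zf: "z \<le> card (?C f)" by simp
    have "2 ^ card A / real n \<le> 2 ^ card A / real (card (?C f))"
      using z zf card_periodic_points_le[of n f] by (intro divide_left_mono) auto
    also have "\<dots> = 2 ^ card A * fact (card (?C f)) / real (card (?C f)) / fact (card (?C f))"
      by simp
    also have "\<dots> \<le> (\<Sum>\<tau> | \<tau> permutes ?C f. ?H (?C f) \<tau>) / fact (card (?C f))"
    proof (intro divide_right_mono sum_Lcm_cycle_lengths_ge A)
      show "\<Sum>A < card (?C f)" using z(1) zf by linarith
      show "\<Sum>A + q < card (?C f)" if "q \<in> A" for q using z(2)[OF that] zf by linarith
    qed auto
    finally show "2 ^ card A / real n \<le> (\<Sum>\<tau> | \<tau> permutes ?C f. ?H (?C f) \<tau>) / fact (card (?C f))" .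
  qed
  also have "\<dots> \<le> (\<Sum>f\<in>?F. (\<Sum>\<tau> | \<tau> permutes ?C f. ?H (?C f) \<tau>) / fact (card (?C f)))"
    by (intro sum_mono2) (auto intro!: divide_nonneg_nonneg sum_nonneg)
  also have "\<dots> = (\<Sum>f\<in>?F. ?H (?C f) f)"
  proof (rule sum_zero_k_mappings_average[symmetric])
    fix C and f g :: "nat \<Rightarrow> nat" assume "\<And>x. x \<in> C \<Longrightarrow> f x = g x"
    then show "?H C f = ?H C g" using cycle_sets_cong[of C f g] by simp
  qed
  also have "\<dots> = (\<Sum>f\<in>?F. real (T_lcm n f))"
    by (simp add: T_lcm_def cycles_eq_cycle_sets)
  finally show ?thesis .
qed

subsection \<open>Mappings with many periodic points\<close>

lemma of_nat_card_filter:
  "finite S \<Longrightarrow> (of_nat (card {x \<in> S. P x}) :: 'a :: semiring_1) = (\<Sum>x\<in>S. if P x then 1 else 0)"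
  by (simp add: sum.If_cases Int_def)

text \<open>Relabelling domain and range independently permutes the fibres. The
  \<open>restrict\<close> restores extensionality, since \<open>undefined\<close> may lie in
  \<open>{1..n}\<close> and be moved by \<open>s\<close>.\<close>

lemma restrict_permuted_zero_k_mapping:
  assumes f: "f \<in> zero_k_mappings k n" and s: "s permutes {1..n}" and \<rho>: "\<rho> permutes {1..n}"
  shows "restrict (s \<circ> f \<circ> \<rho>) {1..n} \<in> zero_k_mappings k n"
proof -
  let ?g = "restrict (s \<circ> f) {1..n}"
  have s_in: "s y \<in> {1..n} \<longleftrightarrow> y \<in> {1..n}" for y using s by (rule permutes_in_image)
  have f_in: "f x \<in> {1..n}" if "x \<in> {1..n}" for x using f that by (auto simp: zero_k_mappings_def simp del: atLeastAtMost_iff)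
  have "?g \<in> zero_k_mappings k n"
  proof -
    have "?g \<in> {1..n} \<rightarrow>\<^sub>E {1..n}"
      by (rule restrict_PiE_iff[THEN iffD2]) (use f_in s_in in simp)
    moreover have "card {x \<in> {1..n}. ?g x = y} \<in> {0, k}" if "y \<in> {1..n}" for y
    proof -
      have "{x \<in> {1..n}. ?g x = y} = {x \<in> {1..n}. f x = inv s y}"
        by (auto simp: permutes_inv_eq[OF s, of y] eq_commute[of "f _" "inv s y"])
      moreover have "inv s y \<in> {1..n}"
        using that permutes_in_image[OF permutes_inv[OF s]] by blast
      ultimately show ?thesis using f unfolding zero_k_mappings_def by auto
    qed
    ultimately show ?thesis unfolding zero_k_mappings_def by blast
  qed
  then have "?g \<circ> \<rho> \<in> zero_k_mappings k n" using \<rho> by (rule zero_k_mappings_comp_permutation)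
  moreover have "?g \<circ> \<rho> = restrict (s \<circ> f \<circ> \<rho>) {1..n}"
    using permutes_in_image[OF \<rho>] permutes_not_in[OF \<rho>] by (intro ext) (simp add: restrict_def del: atLeastAtMost_iff)
  ultimately show ?thesis by simp
qed

text \<open>
  Prescribing one more value \<open>f x\<^sub>0 = y\<^sub>0\<close> outside an injective partial map: by symmetry all choices
  of \<open>x \<notin> A\<close> and \<open>y \<notin> B\<close> are equally likely, and exactly \<open>n - card A * k\<close> points are mapped outside \<open>B\<close>.
\<close>

lemma card_zero_k_mappings_extend:
  assumes A: "A \<subseteq> {1..n}" and g: "inj_on g A" "g ` A \<subseteq> {1..n}"
    and x\<^sub>0: "x\<^sub>0 \<in> {1..n} - A" and y\<^sub>0: "y\<^sub>0 \<in> {1..n} - g ` A"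
  shows "real (card {f \<in> zero_k_mappings k n. \<forall>x\<in>A. f x = g x}) * (real n - real (card A) * real k)
    \<le> (real n - real (card A))\<^sup>2 *
      real (card {f \<in> zero_k_mappings k n. f x\<^sub>0 = y\<^sub>0 \<and> (\<forall>x\<in>A. f x = g x)})"
proof -
  let ?F = "zero_k_mappings k n"
  let ?N = "{f \<in> ?F. \<forall>x\<in>A. f x = g x}" and ?M = "{f \<in> ?F. f x\<^sub>0 = y\<^sub>0 \<and> (\<forall>x\<in>A. f x = g x)}"
  let ?B = "g ` A"
  have card_B: "card ?B = card A" using g(1) by (rule card_image)
  have fin_A: "finite A" using A finite_subset by blast
  \<comment> \<open>Each of the \<open>card A\<close> prescribed values is attained, so its fibre
    has exactly \<open>k\<close> points. All points of \<open>A\<close> lie in these fibres, so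
    excluding \<open>A\<close> does not change the count.\<close>
  have out: "real (card {x \<in> {1..n} - A. f x \<in> {1..n} - ?B}) = real n - real (card A) * real k" if f: "f \<in> ?N" for f
  proof -
    have f_in: "f x \<in> {1..n}" if "x \<in> {1..n}" for x
      using f that by (auto simp: zero_k_mappings_def simp del: atLeastAtMost_iff)
    have pre: "card {x \<in> {1..n}. f x = b} = k" if "b \<in> ?B" for b
    proof -
      have "card {x \<in> {1..n}. f x = b} \<in> {0, k}"
        using f that g(2) by (auto simp: zero_k_mappings_def simp del: atLeastAtMost_iff)
      moreover have "{x \<in> {1..n}. f x = b} \<noteq> {}" using that f A by fastforce
      ultimately show ?thesis by (auto simp: card_eq_0_iff)
    qed
    have "card {x \<in> {1..n}. f x \<in> ?B} = card (\<Union>b\<in>?B. {x \<in> {1..n}. f x = b})"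
      by (rule arg_cong[of _ _ card]) auto
    also have "\<dots> = (\<Sum>b\<in>?B. card {x \<in> {1..n}. f x = b})"
      using fin_A by (intro card_UN_disjoint) auto
    also have "\<dots> = card A * k" using pre card_B by simp
    finally have B: "card {x \<in> {1..n}. f x \<in> ?B} = card A * k" .
    have eq: "{x \<in> {1..n} - A. f x \<in> {1..n} - ?B} = {1..n} - {x \<in> {1..n}. f x \<in> ?B}"
      using f f_in by auto
    have "card {x \<in> {1..n}. f x \<in> ?B} \<le> card {1..n}" by (intro card_mono) auto
    then have le: "card A * k \<le> n" unfolding B by simp
    have "card ({1..n} - {x \<in> {1..n}. f x \<in> ?B}) = card {1..n} - card {x \<in> {1..n}. f x \<in> ?B}"
      by (intro card_Diff_subset) auto
    then show ?thesis
      unfolding eq B using le by (simp add: of_nat_diff)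
  qed
  \<comment> \<open>Swapping \<open>x\<close> with \<open>x\<^sub>0\<close> in the domain and
    \<open>y\<close> with \<open>y\<^sub>0\<close> in the range leaves the prescribed values on
    \<open>A\<close> intact.\<close>
  have le: "card {f \<in> ?N. f x = y} \<le> card ?M"
    if x: "x \<in> {1..n} - A" and y: "y \<in> {1..n} - ?B" for x y
  proof (rule card_inj_on_le)
    let ?s = "Transposition.transpose y y\<^sub>0" and ?\<rho> = "Transposition.transpose x x\<^sub>0"
    let ?h = "\<lambda>f. restrict (?s \<circ> f \<circ> ?\<rho>) {1..n}"
    have s: "?s permutes {1..n}" and \<rho>: "?\<rho> permutes {1..n}"
      using x y x\<^sub>0 y\<^sub>0 by (auto intro!: permutes_swap_id)
    show "inj_on ?h {f \<in> ?N. f x = y}"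
    proof (rule inj_onI, rule ext)
      fix f f' z assume *: "f \<in> {f \<in> ?N. f x = y}" "f' \<in> {f \<in> ?N. f x = y}" "?h f = ?h f'"
      show "f z = f' z"
      proof (cases "z \<in> {1..n}")
        case True
        then have "?\<rho> z \<in> {1..n}" using permutes_in_image[OF \<rho>] by blast
        then have "?s (f z) = ?s (f' z)" using fun_cong[OF *(3), of "?\<rho> z"] by simp
        then show ?thesis by (metis transpose_involutory)
      next
        case False
        then show ?thesis
          using * by (auto simp: zero_k_mappings_def PiE_arb[of _ "{1..n}" "\<lambda>_. {1..n}" z])
      qed
    qed
    show "?h ` {f \<in> ?N. f x = y} \<subseteq> ?M"
    proof (rule image_subsetI)
      fix f assume f: "f \<in> {f \<in> ?N. f x = y}"
      then have "?h f \<in> ?F" using s \<rho> by (intro restrict_permuted_zero_k_mapping) auto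
      moreover have "?h f x\<^sub>0 = y\<^sub>0" using f x\<^sub>0 by simp
      moreover have "?h f a = g a" if a: "a \<in> A" for a
      proof -
        have "a \<in> {1..n}" using a A by blast
        moreover have "?\<rho> a = a" using a x x\<^sub>0 by (intro transpose_apply_other) auto
        moreover have "?s (g a) = g a" using a y y\<^sub>0 by (intro transpose_apply_other) auto
        ultimately show ?thesis using f a by simp
      qed
      ultimately show "?h f \<in> ?M" by blast
    qed
  qed simp
  \<comment> \<open>Double counting of the triples \<open>(f, x, y)\<close> with
    \<open>f x = y\<close>, \<open>x\<close> outside \<open>A\<close> and \<open>y\<close> outside
    \<open>?B\<close>.\<close>
  have "real (card ?N) * (real n - real (card A) * real k) =
      (\<Sum>f\<in>?N. real (card {x \<in> {1..n} - A. f x \<in> {1..n} - ?B}))"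
    using out by simp
  also have "\<dots> = (\<Sum>f\<in>?N. \<Sum>x\<in>{1..n} - A. \<Sum>y\<in>{1..n} - ?B. if f x = y then 1 else 0)"
  proof (rule sum.cong[OF refl])
    fix f :: "nat \<Rightarrow> nat"
    have "(\<Sum>y\<in>{1..n} - ?B. if f x = y then 1 else 0) = (if f x \<in> {1..n} - ?B then 1 else 0 :: real)" for x
      by (rule sum.delta') simp
    then show "real (card {x \<in> {1..n} - A. f x \<in> {1..n} - ?B}) =
        (\<Sum>x\<in>{1..n} - A. \<Sum>y\<in>{1..n} - ?B. if f x = y then 1 else 0)"
      by (subst of_nat_card_filter) (simp_all only: finite_Diff finite_atLeastAtMost)
  qed
  also have "\<dots> = (\<Sum>x\<in>{1..n} - A. \<Sum>f\<in>?N. \<Sum>y\<in>{1..n} - ?B. if f x = y then 1 else 0)"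
    by (rule sum.swap)
  also have "\<dots> = (\<Sum>x\<in>{1..n} - A. \<Sum>y\<in>{1..n} - ?B. \<Sum>f\<in>?N. if f x = y then 1 else 0)"
    by (intro sum.cong refl sum.swap)
  also have "\<dots> = (\<Sum>x\<in>{1..n} - A. \<Sum>y\<in>{1..n} - ?B. real (card {f \<in> ?N. f x = y}))"
    by (intro sum.cong refl of_nat_card_filter[symmetric]) simp
  also have "\<dots> \<le> (\<Sum>x\<in>{1..n} - A. \<Sum>y\<in>{1..n} - ?B. real (card ?M))"
    using le by (intro sum_mono) (simp only: of_nat_le_iff)
  also have "\<dots> = real (card ({1..n} - A)) * real (card ({1..n} - ?B)) * real (card ?M)"
    by simp
  also have "\<dots> = (real n - real (card A))\<^sup>2 * real (card ?M)"
  proof -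
    have "card ({1..n} - A) = n - card A" "card ({1..n} - ?B) = n - card A"
      using A g fin_A card_B by (simp_all add: card_Diff_subset)
    moreover have "card A \<le> n" using card_mono[OF _ A] by simp
    ultimately show ?thesis by (simp add: of_nat_diff power2_eq_square)
  qed
  finally show ?thesis .
qed

text \<open>The values are prescribed one at a time; the factor for \<open>i\<close> bounds the
  conditional probability of the next value when \<open>i\<close> values are fixed.\<close>

lemma card_zero_k_mappings_prescribed_ge:
  assumes A: "A \<subseteq> {1..n}" and g: "inj_on g A" "g ` A \<subseteq> {1..n}" and k: "k \<ge> 1" "card A * k \<le> n"
  shows "real (card (zero_k_mappings k n)) *
      (\<Prod>i<card A. (real n - real i * real k) / (real n - real i)\<^sup>2)
    \<le> real (card {f \<in> zero_k_mappings k n. \<forall>x\<in>A. f x = g x})"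
proof -
  have "finite A" using A finite_subset by blast
  then show ?thesis using assms
  proof (induction A rule: finite_induct)
    case (insert x\<^sub>0 A)
    let ?F = "zero_k_mappings k n" and ?i = "card A"
    let ?p = "\<lambda>i. (real n - real i * real k) / (real n - real i)\<^sup>2"
    have ik: "(?i + 1) * k \<le> n" using insert by simp
    have "?i + 1 \<le> (?i + 1) * k" using mult_le_mono2[of 1 k "?i + 1"] insert.prems(4) by simp
    with ik have i: "?i < n" by linarith
    have "real (?i * k) \<le> real n" unfolding of_nat_le_iff using ik by simp
    then have nonneg: "0 \<le> real n - real ?i * real k" by simp
    have "(real (card ?F) * (\<Prod>i<?i. ?p i)) * ?p ?i
        \<le> real (card {f \<in> ?F. \<forall>x\<in>A. f x = g x}) * ?p ?i"
      using insert nonneg by (intro mult_right_mono insert.IH divide_nonneg_nonneg) auto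
    also have "\<dots> \<le> real (card {f \<in> ?F. f x\<^sub>0 = g x\<^sub>0 \<and> (\<forall>x\<in>A. f x = g x)})"
    proof -
      have "real (card {f \<in> ?F. \<forall>x\<in>A. f x = g x}) * (real n - real ?i * real k)
        \<le> (real n - real ?i)\<^sup>2 * real (card {f \<in> ?F. f x\<^sub>0 = g x\<^sub>0 \<and> (\<forall>x\<in>A. f x = g x)})"
        using insert.prems insert.hyps by (intro card_zero_k_mappings_extend) auto
      then show ?thesis using i by (simp add: divide_le_eq mult.commute)
    qed
    finally show ?case using insert.hyps by (simp add: mult_ac)
  qed simp
qed

text \<open>Cycles are disjoint, so they have distinct minima.\<close>

lemma card_cycles_of_length_le:
  "card {D. D \<subseteq> {1..n} \<and> card D = z \<and> cyclic_on f D} \<le> n"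
proof -
  let ?S = "{D. D \<subseteq> {1..n} \<and> card D = z \<and> cyclic_on f D}"
  have Min: "Min D \<in> D" if "D \<in> ?S" for D
    using that by (intro Min_in) (auto simp: cyclic_on_def intro: finite_subset)
  have "inj_on Min ?S"
  proof (rule inj_onI)
    fix D E assume "D \<in> ?S" "E \<in> ?S" "Min D = Min E"
    then show "D = E" using Min[of D] Min[of E] cyclic_on_eq_if_meet[of f D E "Min D"] by auto
  qed
  moreover have "Min ` ?S \<subseteq> {1..n}" using Min by blast
  ultimately have "card ?S \<le> card {1..n}" by (intro card_inj_on_le) auto
  then show ?thesis by simp
qed

text \<open>Every factor is at least \<open>1 - u\<close> with \<open>u = z * t\<close>, and
  \<open>1 - u \<ge> exp (- 2 * u)\<close> for \<open>0 \<le> u \<le> 1/2\<close>.\<close>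

lemma prod_one_minus_ge_exp:
  fixes t :: real
  assumes "0 \<le> t" "real z * t \<le> 1 / 2"
  shows "exp (- 2 * t * (real z)\<^sup>2) \<le> (\<Prod>i<z. 1 - real i * t)"
proof -
  have "exp (- 2 * t * (real z)\<^sup>2) = (\<Prod>i<z. exp (- 2 * (real z * t)))"
    by (simp add: exp_of_nat_mult[symmetric] power2_eq_square mult_ac)
  also have "\<dots> \<le> (\<Prod>i<z. 1 - real i * t)"
  proof (intro prod_mono conjI)
    fix i assume i: "i \<in> {..<z}"
    define u where "u = real z * t"
    have u: "0 \<le> u" "u \<le> 1 / 2" using assms by (auto simp: u_def)
    have "- 2 * u \<le> - u - 2 * u\<^sup>2"
      using mult_left_mono[of u "1/2" u] u by (simp add: power2_eq_square)
    also have "\<dots> \<le> ln (1 - u)" using u by (intro ln_one_minus_pos_lower_bound)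
    finally have "exp (- 2 * u) \<le> 1 - u" using u by (subst (asm) ln_ge_iff) auto
    also have "\<dots> \<le> 1 - real i * t"
      using i assms(1) by (simp add: u_def mult_right_mono)
    finally show "exp (- 2 * (real z * t)) \<le> 1 - real i * t" by (simp add: u_def)
  qed simp
  finally show ?thesis .
qed

lemma prod_lessThan_minus_eq:
  "z \<le> n \<Longrightarrow> (\<Prod>i<z. real n - real i) * fact (n - z) = fact n"
proof (induction z)
  case (Suc z)
  then have "fact (n - z) = (real n - real z) * fact (n - Suc z)"
    using fact_reduce[of "n - z", where 'a = real] by (simp add: of_nat_diff)
  with Suc show ?case by (simp add: mult_ac)
qed simp

text \<open>First moment of the number of cycles of length \<open>z\<close>, of which there are at most \<open>n\<close>.\<close>

lemma card_many_periodic_points_ge: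
  assumes k: "k \<ge> 1" and z: "z > 0" "2 * z * k \<le> n"
  shows "real (card (zero_k_mappings k n)) * exp (- 2 * real k * (real z)\<^sup>2 / real n) / (real n)\<^sup>2
    \<le> real (card {f \<in> zero_k_mappings k n. z \<le> card (periodic_points n f)})"
proof -
  let ?F = "zero_k_mappings k n" and ?C = "periodic_points n"
  let ?Ds = "{D. D \<subseteq> {1..n} \<and> card D = z}"
  let ?X = "\<lambda>D. {\<delta>. \<delta> permutes D \<and> cyclic_on \<delta> D}"
  let ?N = "\<lambda>D \<delta>. {f \<in> ?F. \<forall>x\<in>D. f x = \<delta> x}"
  define p where "p = (\<Prod>i<z. (real n - real i * real k) / (real n - real i)\<^sup>2)"
  have "z \<le> z * k" using k by simp
  with z have zk: "z * k \<le> n" and zn: "z \<le> n" and n: "n > 0" by linarith+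
  have ik: "i * k \<le> n" if "i < z" for i
    using mult_le_mono1[of i z k] that zk by linarith
  have pos: "0 \<le> real n - real i * real k" "real i < real n" if "i < z" for i
  proof -
    have "real (i * k) \<le> real n" unfolding of_nat_le_iff by (rule ik[OF that])
    then show "0 \<le> real n - real i * real k" by simp
  qed (use that zn in simp)
  have p_nonneg: "p \<ge> 0"
    unfolding p_def using pos by (intro prod_nonneg divide_nonneg_nonneg) auto
  \<comment> \<open>Every cyclic permutation of \<open>D\<close> is matched by at least the fraction
    \<open>p\<close> of the mappings, and different permutations are matched by disjoint sets of
    mappings.\<close>
  have each: "fact (z - 1) * (real (card ?F) * p) \<le> real (card {f \<in> ?F. cyclic_on f D})" if D: "D \<in> ?Ds" for D
  proof -
    have fin_D: "finite D" and ne: "D \<noteq> {}" using D z by (auto intro: finite_subset)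
    have fin_X: "finite (?X D)" using finite_permutations[OF fin_D] by (rule rev_finite_subset) auto
    have "fact (z - 1) \<le> card (?X D)" using card_cyclic_permutations_ge[OF fin_D ne] D by simp
    then have "real (fact (z - 1)) \<le> real (card (?X D))" by (simp only: of_nat_le_iff)
    then have "fact (z - 1) * (real (card ?F) * p) \<le> real (card (?X D)) * (real (card ?F) * p)"
      using p_nonneg by (intro mult_right_mono) auto
    also have "\<dots> = (\<Sum>\<delta>\<in>?X D. real (card ?F) * p)" by simp
    also have "\<dots> \<le> (\<Sum>\<delta>\<in>?X D. real (card (?N D \<delta>)))"
    proof (rule sum_mono)
      fix \<delta> assume "\<delta> \<in> ?X D"
      then have "\<delta> permutes D" by simp
      then have "inj_on \<delta> D" "\<delta> ` D \<subseteq> {1..n}"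
        using D permutes_inj_on permutes_image[of \<delta> D] by auto
      then show "real (card ?F) * p \<le> real (card (?N D \<delta>))"
        using card_zero_k_mappings_prescribed_ge[of D n \<delta> k] D k zk by (simp add: p_def)
    qed
    also have "\<dots> = real (card (\<Union>\<delta>\<in>?X D. ?N D \<delta>))"
    proof -
      have "?N D \<delta> \<inter> ?N D \<delta>' = {}" if *: "\<delta> \<in> ?X D" "\<delta>' \<in> ?X D" "\<delta> \<noteq> \<delta>'" for \<delta> \<delta>'
      proof (rule equals0I)
        fix f assume f: "f \<in> ?N D \<delta> \<inter> ?N D \<delta>'"
        have "\<delta> x = \<delta>' x" for x
        proof (cases "x \<in> D")
          case True
          then show ?thesis using f by auto
        next
          case False
          then show ?thesis using * permutes_not_in[of \<delta> D x] permutes_not_in[of \<delta>' D x] by simp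
        qed
        then show False using *(3) by auto
      qed
      then show ?thesis
        using fin_X by (subst card_UN_disjoint) simp_all
    qed
    also have "\<dots> \<le> real (card {f \<in> ?F. cyclic_on f D})"
    proof -
      have "(\<Union>\<delta>\<in>?X D. ?N D \<delta>) \<subseteq> {f \<in> ?F. cyclic_on f D}"
      proof
        fix f assume "f \<in> (\<Union>\<delta>\<in>?X D. ?N D \<delta>)"
        then obtain \<delta> where "\<delta> \<in> ?X D" "f \<in> ?N D \<delta>" by blast
        then show "f \<in> {f \<in> ?F. cyclic_on f D}" using cyclic_cong[of D f \<delta>] by simp
      qed
      then have "card (\<Union>\<delta>\<in>?X D. ?N D \<delta>) \<le> card {f \<in> ?F. cyclic_on f D}"
        by (intro card_mono) simp_all
      then show ?thesis by (simp only: of_nat_le_iff)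
    qed
    finally show ?thesis .
  qed
  \<comment> \<open>Here \<open>1 / z\<close> is bounded below by \<open>1 / n\<close>; the second
    factor \<open>n\<close> in the claim comes from the number of cycles of length
    \<open>z\<close>.\<close>
  have "real (card ?F) * exp (- 2 * real k * (real z)\<^sup>2 / real n) / real n
      \<le> real (card ?F) * (\<Prod>i<z. (real n - real i * real k) / (real n - real i)) / real z"
  proof (intro frac_le mult_left_mono mult_nonneg_nonneg prod_nonneg)
    have "exp (- 2 * (real k / real n) * (real z)\<^sup>2) \<le> (\<Prod>i<z. 1 - real i * (real k / real n))"
    proof (rule prod_one_minus_ge_exp)
      have "real (2 * z * k) \<le> real n" using z(2) by (simp only: of_nat_le_iff)
      then show "real z * (real k / real n) \<le> 1 / 2" using n by (simp add: field_simps)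
    qed simp
    also have "\<dots> \<le> (\<Prod>i<z. (real n - real i * real k) / (real n - real i))"
    proof (intro prod_mono conjI)
      fix i assume "i \<in> {..<z}"
      then have i: "i < z" by simp
      have "1 - real i * (real k / real n) = (real n - real i * real k) / real n"
        using n by (simp add: field_simps)
      moreover have "0 \<le> (real n - real i * real k) / real n" using pos[OF i] by simp
      moreover have "(real n - real i * real k) / real n \<le> (real n - real i * real k) / (real n - real i)"
        using pos[OF i] by (intro divide_left_mono) auto
      ultimately show "0 \<le> 1 - real i * (real k / real n)"
        "1 - real i * (real k / real n) \<le> (real n - real i * real k) / (real n - real i)" by simp_all
    qed
    finally show "exp (- 2 * real k * (real z)\<^sup>2 / real n)
        \<le> (\<Prod>i<z. (real n - real i * real k) / (real n - real i))" by simp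
  qed (use pos z zn in \<open>auto intro!: divide_nonneg_nonneg\<close>)
  \<comment> \<open>The falling factorial \<open>(n choose z) * fact (z - 1) * z\<close> cancels one
    of the two factors \<open>n - i\<close> in each denominator of \<open>p\<close>.\<close>
  also have "\<dots> = real (n choose z) * (fact (z - 1) * (real (card ?F) * p))"
  proof -
    have "real (n choose z) * fact (z - 1) * real z * fact (n - z) = (\<Prod>i<z. real n - real i) * fact (n - z)"
      using binomial_fact_lemma[OF zn, THEN arg_cong[of _ _ real]] fact_reduce[OF z(1), where 'a = real]
        prod_lessThan_minus_eq[OF zn]
      by (simp add: mult_ac)
    then have 1: "real (n choose z) * fact (z - 1) = (\<Prod>i<z. real n - real i) / real z"
      using z by (simp add: field_simps)
    have 2: "(\<Prod>i<z. real n - real i) * p = (\<Prod>i<z. (real n - real i * real k) / (real n - real i))"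
      unfolding p_def prod.distrib[symmetric] using pos
      by (intro prod.cong refl) (simp add: power2_eq_square)
    have "real (n choose z) * (fact (z - 1) * (real (card ?F) * p)) =
        real (card ?F) * (real (n choose z) * fact (z - 1) * p)"
      by (simp only: mult_ac)
    also have "\<dots> = real (card ?F) * ((\<Prod>i<z. real n - real i) * p) / real z"
      unfolding 1 by simp
    finally show ?thesis unfolding 2 ..
  qed
  also have "\<dots> = (\<Sum>D\<in>?Ds. fact (z - 1) * (real (card ?F) * p))"
    using n_subsets[of "{1..n}" z] by simp
  also have "\<dots> \<le> (\<Sum>D\<in>?Ds. real (card {f \<in> ?F. cyclic_on f D}))"
    by (rule sum_mono) (rule each)
  also have "\<dots> = (\<Sum>D\<in>?Ds. \<Sum>f\<in>?F. if cyclic_on f D then 1 else 0)"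
    by (intro sum.cong refl of_nat_card_filter) simp
  also have "\<dots> = (\<Sum>f\<in>?F. \<Sum>D\<in>?Ds. if cyclic_on f D then 1 else 0)"
    by (rule sum.swap)
  also have "\<dots> = (\<Sum>f\<in>?F. real (card {D. D \<subseteq> {1..n} \<and> card D = z \<and> cyclic_on f D}))"
    by (intro sum.cong refl, subst of_nat_card_filter[symmetric]) (simp_all add: conj_assoc)
  also have "\<dots> \<le> (\<Sum>f\<in>?F. if z \<le> card (?C f) then real n else 0)"
  proof (rule sum_mono)
    fix f
    have "z \<le> card (?C f)" if "D \<subseteq> {1..n}" "card D = z" "cyclic_on f D" for D
      using card_mono[OF finite_periodic_points periodic_points_upper[OF that(1) cyclic_on_image_eq[OF that(3)]]] that(2)
      by simp
    then show "real (card {D. D \<subseteq> {1..n} \<and> card D = z \<and> cyclic_on f D}) \<le> (if z \<le> card (?C f) then real n else 0)"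
      using card_cycles_of_length_le[of n z f] by (auto simp: card_eq_0_iff)
  qed
  also have "\<dots> = real n * card {f \<in> ?F. z \<le> card (?C f)}"
    by (simp add: sum.If_cases Int_def)
  finally show ?thesis using n by (simp add: field_simps power2_eq_square)
qed

subsection \<open>The expected period and the waiting time\<close>

text \<open>All primes up to \<open>x\<close> are used, with \<open>z = x\<^sup>2 + 1\<close>. The
  main term is Chebyshev's bound for \<open>card A * ln 2\<close>; \<open>3 * ln n\<close> collects
  the factors \<open>n\<close> and \<open>n\<^sup>2\<close> lost before, and the last term is the
  cost of having \<open>z\<close> periodic points.\<close>

lemma ln_expected_T_ge_aux:
  assumes k: "k \<ge> 1" and x: "x \<ge> 2" "2 * (x\<^sup>2 + 1) * k \<le> n" and ne: "zero_k_mappings k n \<noteq> {}"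
  shows "expected_T k n > 0"
    and "(ln 2)\<^sup>2 * (real x - 2) / ln (real n) - 3 * ln (real n) - 8 * real k * real x ^ 4 / real n
      \<le> ln (expected_T k n)"
proof -
  let ?F = "zero_k_mappings k n" and ?C = "periodic_points n"
  define A where "A = {p. prime p \<and> p \<le> x}"
  define z where "z = x\<^sup>2 + 1"
  have fin_A: "finite A" by (simp add: A_def)
  have "x * 1 \<le> x * x" using x by (intro mult_le_mono) auto
  also have "\<dots> \<le> 2 * (x\<^sup>2 + 1) * 1" by (simp add: power2_eq_square)
  also have "\<dots> \<le> 2 * (x\<^sup>2 + 1) * k" using k by (intro mult_le_mono) auto
  finally have xn: "x \<le> n" using x(2) by simp
  have n: "n > 1" using xn x by simp
  have F_pos: "real (card ?F) > 0" using ne by (simp add: card_gt_0_iff)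
  have "A \<subseteq> {2..x}" by (auto simp: A_def prime_ge_2_nat)
  then have "card A \<le> card {2..x}" by (intro card_mono) auto
  then have card_A: "card A \<le> x - 1" by simp
  have "\<Sum>A \<le> card A * x" using sum_bounded_above[of A "\<lambda>p. p" x] by (simp add: A_def)
  also have "\<dots> \<le> (x - 1) * x" using card_A by (rule mult_le_mono1)
  \<comment> \<open>As every prime in \<open>A\<close> is at most \<open>x\<close>, both size
    conditions on \<open>z\<close> follow from this.\<close>
  finally have sum_A: "\<Sum>A + x \<le> x\<^sup>2"
    using x by (cases x) (auto simp: power2_eq_square)
  define e where "e = 2 ^ card A / real n * (exp (- 2 * real k * (real z)\<^sup>2 / real n) / (real n)\<^sup>2)"
  have "e * real (card ?F) = 2 ^ card A / real n *
      (real (card ?F) * exp (- 2 * real k * (real z)\<^sup>2 / real n) / (real n)\<^sup>2)"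
    by (simp add: e_def)
  also have "\<dots> \<le> 2 ^ card A / real n * real (card {f \<in> ?F. z \<le> card (?C f)})"
    using k x(2) by (intro mult_left_mono card_many_periodic_points_ge) (auto simp: z_def)
  also have "\<dots> \<le> (\<Sum>f\<in>?F. real (T_lcm n f))"
    using sum_A by (intro sum_T_lcm_ge fin_A) (auto simp: A_def z_def)
  finally have "e \<le> (\<Sum>f\<in>?F. real (T_lcm n f)) / real (card ?F)"
    using F_pos by (simp add: pos_le_divide_eq)
  also have "\<dots> = expected_T k n"
    by (simp add: expected_T_def integral_uniform_count_measure)
  finally have e_le: "e \<le> expected_T k n" .
  have e_pos: "e > 0" using n by (simp add: e_def)
  with e_le show "expected_T k n > 0" by simp
  have "ln e = card A * ln 2 - 3 * ln n - 2 * real k * (real z)\<^sup>2 / real n"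
    unfolding e_def using n by (simp add: ln_mult ln_div ln_realpow)
  moreover have "(ln 2)\<^sup>2 * (real x - 2) / ln (real n) \<le> card A * ln 2"
  proof -
    have "ln 2 * (real x - 2) \<le> card A * ln (real x)"
      using card_primes_lower_bound[of x] x by (simp add: A_def mult.commute)
    also have "\<dots> \<le> card A * ln (real n)" using xn x by (intro mult_left_mono) auto
    finally have "ln 2 * (ln 2 * (real x - 2)) \<le> ln 2 * (card A * ln (real n))"
      by (intro mult_left_mono) auto
    then show ?thesis using n by (simp add: divide_le_eq power2_eq_square mult_ac)
  qed
  moreover have "2 * real k * (real z)\<^sup>2 / real n \<le> 8 * real k * real x ^ 4 / real n"
  proof (rule divide_right_mono)
    have "(1::real) \<le> (real x)\<^sup>2" using x by (intro one_le_power) auto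
    then have "real z \<le> 2 * (real x)\<^sup>2" by (simp add: z_def)
    then have "(real z)\<^sup>2 \<le> (2 * (real x)\<^sup>2)\<^sup>2" by (intro power_mono) auto
    also have "\<dots> = 4 * real x ^ 4" by (simp add: power_mult_distrib flip: power_mult)
    finally have "2 * real k * (real z)\<^sup>2 \<le> 2 * real k * (4 * real x ^ 4)"
      by (intro mult_left_mono) auto
    then show "2 * real k * (real z)\<^sup>2 \<le> 8 * real k * real x ^ 4" by simp
  qed simp
  moreover have "ln e \<le> ln (expected_T k n)" using e_le e_pos by simp
  ultimately show "(ln 2)\<^sup>2 * (real x - 2) / ln (real n) - 3 * ln (real n) - 8 * real k * real x ^ 4 / real n
      \<le> ln (expected_T k n)" by linarith
qed

text \<open>With \<open>x\<close> about \<open>n powr (1/3) / ln n\<close> the main term has order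
  \<open>n powr (1/3) / ln\<^sup>2 n\<close> and the cost \<open>8 * k * x ^ 4 / n\<close> only
  \<open>n powr (1/3) / ln ^ 4 n\<close>. The claimed power \<open>ln ^ 3\<close> absorbs all
  constants.\<close>

lemma eventually_ln_expected_T_ge:
  assumes k: "k \<ge> 1"
  shows "\<forall>\<^sub>F n in at_top. zero_k_mappings k n \<noteq> {} \<longrightarrow>
    expected_T k n > 0 \<and> real n powr (1/3) / ln (real n) ^ 3 \<le> ln (expected_T k n)"
proof -
  define y where "y n = real n powr (1/3) / ln (real n)" for n
  have k0: "real k > 0" using k by simp
  have "\<forall>\<^sub>F n in at_top. y n \<ge> 3"
    unfolding y_def by real_asymp
  moreover have "\<forall>\<^sub>F n in at_top. 2 * ((y n)\<^sup>2 + 1) * real k \<le> real n"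
    unfolding y_def using k0 by real_asymp
  \<comment> \<open>\<open>y n - 3\<close> instead of \<open>x - 2\<close> allows for rounding
    \<open>y n\<close> down to \<open>x\<close>.\<close>
  moreover have "\<forall>\<^sub>F n in at_top. real n powr (1/3) / ln (real n) ^ 3
      \<le> (ln 2)\<^sup>2 * (y n - 3) / ln (real n) - 3 * ln (real n) - 8 * real k * y n ^ 4 / real n"
    unfolding y_def using k0 by real_asymp
  ultimately show ?thesis
    using eventually_gt_at_top[of 1]
  proof eventually_elim
    case (elim n)
    define x where "x = nat \<lfloor>y n\<rfloor>"
    have x_le: "real x \<le> y n" and x_ge: "y n - 1 \<le> real x"
      using elim(1) by (simp_all add: x_def)
    have x2: "x \<ge> 2" using elim(1) x_ge by simp
    have "2 * ((real x)\<^sup>2 + 1) * real k \<le> 2 * ((y n)\<^sup>2 + 1) * real k"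
      using x_le by (intro mult_right_mono mult_left_mono add_right_mono power_mono) auto
    also have "\<dots> \<le> real n" by (rule elim(2))
    finally have "real (2 * (x\<^sup>2 + 1) * k) \<le> real n"
      by (simp add: algebra_simps)
    then have xk: "2 * (x\<^sup>2 + 1) * k \<le> n" by (simp only: of_nat_le_iff)
    have "(ln 2)\<^sup>2 * (y n - 3) / ln (real n) \<le> (ln 2)\<^sup>2 * (real x - 2) / ln (real n)"
      using x_ge elim(4) by (intro divide_right_mono mult_left_mono) auto
    moreover have "8 * real k * real x ^ 4 / real n \<le> 8 * real k * y n ^ 4 / real n"
      using x_le by (intro divide_right_mono mult_left_mono power_mono) auto
    ultimately show ?case
      using ln_expected_T_ge_aux[OF k x2 xk] elim(3) by (intro impI conjI) force+
  qed
qed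

section \<open>From one trial to the waiting time\<close>

lemma iid_uniform_mappings_prob:
  assumes iid: "iid_uniform_mappings k n M F" and t: "t \<ge> 1" and A: "A \<subseteq> zero_k_mappings k n"
  shows "F t -` A \<inter> space M \<in> sets M"
    and "measure M (F t -` A \<inter> space M) = real (card A) / real (card (zero_k_mappings k n))"
proof -
  let ?N = "count_space (zero_k_mappings k n)"
  interpret prob_space M using iid by (simp add: iid_uniform_mappings_def)
  have F: "F t \<in> measurable M ?N"
    using iid t by (auto simp: iid_uniform_mappings_def indep_vars_def)
  then show "F t -` A \<inter> space M \<in> sets M" using A by (auto intro: measurable_sets)
  have "measure M (F t -` A \<inter> space M) = measure (distr M ?N (F t)) A"
    using F A by (simp add: measure_distr)
  also have "distr M ?N (F t) = uniform_count_measure (zero_k_mappings k n)"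
    using iid t by (simp add: iid_uniform_mappings_def)
  finally show "measure M (F t -` A \<inter> space M) = real (card A) / real (card (zero_k_mappings k n))"
    using A by (simp add: measure_uniform_count_measure)
qed

text \<open>A probability space is nonempty, so the values of \<open>F 1\<close> witness that a
  mapping exists; no explicit mapping has to be constructed.\<close>

lemma iid_uniform_mappings_nonempty:
  assumes "iid_uniform_mappings k n M F"
  shows "zero_k_mappings k n \<noteq> {}"
proof
  assume empty: "zero_k_mappings k n = {}"
  interpret prob_space M using assms by (simp add: iid_uniform_mappings_def)
  have "F 1 \<in> measurable M (count_space (zero_k_mappings k n))"
    using assms by (auto simp: iid_uniform_mappings_def indep_vars_def)
  then show False using not_empty empty by (auto simp: measurable_def)
qed

lemma waiting_time_le_imp:
  assumes "ennreal_of_enat (waiting_time n \<xi> F \<omega>) \<le> ennreal s" "s \<ge> 0"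
  obtains t where "t \<in> {1..nat \<lfloor>s\<rfloor>}" "\<xi> \<le> real (T_lcm n (F t \<omega>))"
proof -
  let ?S = "{t. t \<ge> 1 \<and> real (T_lcm n (F t \<omega>)) \<ge> \<xi>}"
  have "?S \<noteq> {}"
  proof
    assume empty: "?S = {}"
    then have "waiting_time n \<xi> F \<omega> = \<infinity>"
      unfolding waiting_time_def empty by (simp add: Inf_enat_def)
    with assms(1) show False by (simp add: top_unique)
  qed
  then have "waiting_time n \<xi> F \<omega> \<in> enat ` ?S"
    unfolding waiting_time_def Inf_enat_def by (auto intro: LeastI)
  then obtain t where t: "t \<in> ?S" "waiting_time n \<xi> F \<omega> = enat t" by blast
  with assms have "ennreal (real t) \<le> ennreal s"
    by (simp add: ennreal_of_nat_eq_real_of_nat)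
  then have "real t \<le> s" using assms(2) by (simp add: ennreal_le_iff)
  then have "t \<le> nat \<lfloor>s\<rfloor>" by (simp add: le_nat_floor)
  with t that show thesis by auto
qed

text \<open>A union bound over the first \<open>\<lfloor>s\<rfloor>\<close> trials.\<close>

lemma waiting_time_bounds:
  fixes M :: "'w measure"
  assumes iid: "iid_uniform_mappings k n M F" and s: "s \<ge> 0"
    and p: "p = real (card {f \<in> zero_k_mappings k n. \<xi> \<le> real (T_lcm n f)}) / real (card (zero_k_mappings k n))"
  shows "measure M {\<omega> \<in> space M. ennreal_of_enat (waiting_time n \<xi> F \<omega>) \<le> ennreal s} \<le> s * p"
    and "ennreal (s * (1 - s * p)) \<le> (\<integral>\<^sup>+\<omega>. ennreal_of_enat (waiting_time n \<xi> F \<omega>) \<partial>M)"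
proof -
  interpret prob_space M using iid by (simp add: iid_uniform_mappings_def)
  let ?W = "\<lambda>\<omega>. ennreal_of_enat (waiting_time n \<xi> F \<omega>)"
  let ?A = "{f \<in> zero_k_mappings k n. \<xi> \<le> real (T_lcm n f)}"
  define B where "B = (\<Union>t\<in>{1..nat \<lfloor>s\<rfloor>}. F t -` ?A \<inter> space M)"
  have E: "F t -` ?A \<inter> space M \<in> sets M" "measure M (F t -` ?A \<inter> space M) = p" if "t \<in> {1..nat \<lfloor>s\<rfloor>}" for t
    using iid_uniform_mappings_prob[OF iid, of t ?A] that p by auto
  have B_sets: "B \<in> sets M" unfolding B_def using E by blast
  have "p \<ge> 0" by (simp add: p)
  have "measure M B \<le> (\<Sum>t\<in>{1..nat \<lfloor>s\<rfloor>}. measure M (F t -` ?A \<inter> space M))"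
    unfolding B_def using E by (intro finite_measure_subadditive_finite) auto
  also have "\<dots> = real (nat \<lfloor>s\<rfloor>) * p" using E by simp
  also have "\<dots> \<le> s * p" using s \<open>p \<ge> 0\<close> by (intro mult_right_mono) auto
  finally have B: "measure M B \<le> s * p" .
  have F_in: "F t \<omega> \<in> zero_k_mappings k n" if "t \<ge> 1" "\<omega> \<in> space M" for t \<omega>
  proof -
    have "F t \<in> measurable M (count_space (zero_k_mappings k n))"
      using iid that(1) by (auto simp: iid_uniform_mappings_def indep_vars_def)
    then show ?thesis using that(2) by (auto dest: measurable_space)
  qed
  have sub: "{\<omega> \<in> space M. ?W \<omega> \<le> ennreal s} \<subseteq> B"
  proof
    fix \<omega> assume \<omega>: "\<omega> \<in> {\<omega> \<in> space M. ?W \<omega> \<le> ennreal s}"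
    then obtain t where "t \<in> {1..nat \<lfloor>s\<rfloor>}" "\<xi> \<le> real (T_lcm n (F t \<omega>))"
      using s waiting_time_le_imp[of n \<xi> F \<omega> s] by blast
    then show "\<omega> \<in> B" using \<omega> F_in[of t \<omega>] by (auto simp: B_def)
  qed
  \<comment> \<open>Monotonicity of \<open>emeasure\<close> asks for measurability of the larger set
    \<open>B\<close> only.\<close>
  then have "measure M {\<omega> \<in> space M. ?W \<omega> \<le> ennreal s} \<le> measure M B"
    using B_sets by (simp add: measure_def enn2real_mono emeasure_mono less_top[symmetric])
  then show "measure M {\<omega> \<in> space M. ?W \<omega> \<le> ennreal s} \<le> s * p" using B by linarith
  \<comment> \<open>Off \<open>B\<close> the waiting time exceeds \<open>s\<close>, so its
    expectation is at least \<open>s\<close> times the probability of the complement of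
    \<open>B\<close>.\<close>
  have "ennreal (s * (1 - s * p)) \<le> ennreal (s * measure M (space M - B))"
    using B B_sets s by (intro ennreal_leI mult_left_mono) (auto simp: prob_compl)
  also have "\<dots> = ennreal s * emeasure M (space M - B)"
    using s by (simp add: ennreal_mult emeasure_eq_measure)
  also have "\<dots> = (\<integral>\<^sup>+\<omega>. ennreal s * indicator (space M - B) \<omega> \<partial>M)"
    using B_sets by (subst nn_integral_cmult_indicator) auto
  also have "\<dots> \<le> (\<integral>\<^sup>+\<omega>. ?W \<omega> \<partial>M)"
    using sub by (intro nn_integral_mono) (auto simp: indicator_def not_le intro: less_imp_le)
  finally show "ennreal (s * (1 - s * p)) \<le> (\<integral>\<^sup>+\<omega>. ?W \<omega> \<partial>M)" .
qed

lemma eventually_at_top_multiples: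
  "eventually P (at_top_multiples k) \<longleftrightarrow> (\<forall>\<^sub>F n in at_top. k dvd n \<longrightarrow> P n)"
  by (simp add: at_top_multiples_def eventually_inf_principal)

theorem theorem6p3:
  fixes k :: nat and a :: "nat \<Rightarrow> real" and lam :: real and \<xi> :: "nat \<Rightarrow> real"
  assumes k: "k \<ge> 2"
    and lambda: "lam = real k - 1"
    and a_pos: "\<And>n. n > 0 \<Longrightarrow> k dvd n \<Longrightarrow> a n > 0"
    and a_asymp: "(\<lambda>n. inverse (a n) * ln (real n) powr (-1/3)) \<in> o[at_top_multiples k](\<lambda>_. 1)"
    and xi: "\<And>n. n > 0 \<Longrightarrow> k dvd n \<Longrightarrow> \<xi> n = expected_T k n powr a n"
  shows "\<forall>\<^sub>F n in at_top_multiples k.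
    \<forall>(M :: 'w measure) (F :: nat \<Rightarrow> 'w \<Rightarrow> (nat \<Rightarrow> nat)).
      iid_uniform_mappings k n M F \<longrightarrow>
        (\<integral>\<^sup>+\<omega>. ennreal_of_enat (waiting_time n (\<xi> n) F \<omega>) \<partial>M)
          > ennreal (exp (lam * real n powr (1/3) / (3 * ln (real n) ^ 6))) \<and>
        measure M {\<omega> \<in> space M. ennreal_of_enat (waiting_time n (\<xi> n) F \<omega>)
              \<le> ennreal (exp (lam * real n powr (1/3) / (4 * ln (real n) ^ 6)))}
          \<le> exp (- (lam * real n powr (1/3) / (12 * ln (real n) ^ 6)))"
proof -
  have lam: "lam > 0" using k lambda by simp
  \<comment> \<open>The o-condition with constant 1 yields \<open>a n \<ge> ln n powr (-1/3)\<close>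
    for large \<open>n\<close>.\<close>
  have "\<forall>\<^sub>F n in at_top_multiples k. \<bar>inverse (a n) * ln (real n) powr (-1/3)\<bar> \<le> 1"
    using landau_o.smallD[OF a_asymp, of 1] by simp
  moreover have "\<forall>\<^sub>F n in at_top. zero_k_mappings k n \<noteq> {} \<longrightarrow>
      expected_T k n > 0 \<and> real n powr (1/3) / ln (real n) ^ 3 \<le> ln (expected_T k n)"
    using k by (intro eventually_ln_expected_T_ge) simp
  \<comment> \<open>The exponent on the left has order
    \<open>n powr (1/3) / ln n powr (13/3)\<close>, which outweighs
    \<open>n powr (1/3) / ln ^ 6 n\<close>, the factor \<open>n + 1\<close> and the constant
    8.\<close>
  moreover have "\<forall>\<^sub>F n in at_top.
      (real n + 1) * exp (- (ln 2 * (ln (real n) powr (-1/3) * (real n powr (1/3) / ln (real n) ^ 3)) / ln (real n)))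
        \<le> exp (- (lam * real n powr (1/3) / (3 * ln (real n) ^ 6))) / 8"
    using lam by real_asymp
  moreover have "\<forall>\<^sub>F n in at_top. n > (1::nat)" by (rule eventually_gt_at_top)
  ultimately show ?thesis unfolding eventually_at_top_multiples
  proof eventually_elim
    case (elim n)
    show ?case
    proof (intro impI allI)
      fix M :: "'w measure" and F :: "nat \<Rightarrow> 'w \<Rightarrow> (nat \<Rightarrow> nat)"
      assume dvd: "k dvd n" and iid: "iid_uniform_mappings k n M F"
      let ?F = "zero_k_mappings k n" and ?A = "{f \<in> zero_k_mappings k n. \<xi> n \<le> real (T_lcm n f)}"
      define L where "L = lam * real n powr (1/3) / ln (real n) ^ 6"
      define p where "p = real (card ?A) / real (card ?F)"
      have n: "n > 1" by (rule elim(4))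
      have ln_pos: "ln (real n) > 0" using n by simp
      have ne: "?F \<noteq> {}" using iid by (rule iid_uniform_mappings_nonempty)
      then have F_pos: "real (card ?F) > 0" by (simp add: card_gt_0_iff)
      have an: "a n > 0" using a_pos dvd n by simp
      have "ln (real n) powr (-1/3) \<le> a n"
        using elim(1) dvd an by (simp add: abs_mult field_simps)
      moreover have ET: "expected_T k n > 0" "real n powr (1/3) / ln (real n) ^ 3 \<le> ln (expected_T k n)"
        using elim(2) ne by auto
      ultimately have "ln (real n) powr (-1/3) * (real n powr (1/3) / ln (real n) ^ 3) \<le> a n * ln (expected_T k n)"
        using an ln_pos by (intro mult_mono) auto
      also have "\<dots> = ln (\<xi> n)" using xi dvd n ET by (simp add: ln_powr)
      finally have ln_xi: "ln (real n) powr (-1/3) * (real n powr (1/3) / ln (real n) ^ 3) \<le> ln (\<xi> n)" .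
      have "p \<le> (real n + 1) * exp (- (ln 2 * ln (\<xi> n) / ln (real n)))"
        unfolding p_def using card_T_lcm_ge_le[of n "\<xi> n" k] n xi dvd ET F_pos
        by (simp add: divide_le_eq)
      also have "\<dots> \<le> (real n + 1) * exp (- (ln 2 * (ln (real n) powr (-1/3) * (real n powr (1/3) / ln (real n) ^ 3)) / ln (real n)))"
        using ln_xi ln_pos
        by (intro mult_left_mono iffD2[OF exp_le_cancel_iff] iffD2[OF neg_le_iff_le] divide_right_mono) auto
      also have "\<dots> \<le> exp (- (lam * real n powr (1/3) / (3 * ln (real n) ^ 6))) / 8" by (rule elim(3))
      also have "\<dots> = exp (- (L / 3)) / 8" by (simp add: L_def mult_ac)
      finally have p_le: "p \<le> exp (- (L / 3)) / 8" .
      have L4: "lam * real n powr (1/3) / (4 * ln (real n) ^ 6) = L / 4"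
        and L3: "lam * real n powr (1/3) / (3 * ln (real n) ^ 6) = L / 3"
        and L12: "lam * real n powr (1/3) / (12 * ln (real n) ^ 6) = L / 12"
        by (simp_all add: L_def)
      \<comment> \<open>The factor 2 makes the inequality strict: \<open>s * p \<le> 1/4\<close>, so
        \<open>s * (1 - s * p)\<close> is at least \<open>3/2 * exp (L / 3)\<close>.\<close>
      define s where "s = 2 * exp (L / 3)"
      have "s * p \<le> s * (exp (- (L / 3)) / 8)"
        using p_le by (intro mult_left_mono) (auto simp: s_def)
      also have "\<dots> = 1 / 4" by (simp add: s_def exp_minus)
      finally have "s * (3 / 4) \<le> s * (1 - s * p)"
        by (intro mult_left_mono) (auto simp: s_def)
      then have "exp (L / 3) < s * (1 - s * p)"
        using exp_gt_zero[of "L / 3"] unfolding s_def by linarith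
      then have "ennreal (exp (L / 3)) < ennreal (s * (1 - s * p))"
        by (simp add: ennreal_less_iff)
      also have "\<dots> \<le> (\<integral>\<^sup>+\<omega>. ennreal_of_enat (waiting_time n (\<xi> n) F \<omega>) \<partial>M)"
        using waiting_time_bounds(2)[OF iid _ p_def, of s] by (simp add: s_def)
      finally have 1: "ennreal (exp (L / 3)) < (\<integral>\<^sup>+\<omega>. ennreal_of_enat (waiting_time n (\<xi> n) F \<omega>) \<partial>M)" .
      \<comment> \<open>Union bound with threshold \<open>exp (L / 4)\<close>; the exponent 12
        arises from \<open>1/4 - 1/3 = - 1/12\<close>.\<close>
      have "measure M {\<omega> \<in> space M. ennreal_of_enat (waiting_time n (\<xi> n) F \<omega>) \<le> ennreal (exp (L / 4))}
          \<le> exp (L / 4) * p"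
        by (rule waiting_time_bounds(1)[OF iid _ p_def]) simp
      also have "\<dots> \<le> exp (L / 4) * exp (- (L / 3))"
        using p_le exp_gt_zero[of "- (L / 3)"] by (intro mult_left_mono) (linarith, simp)
      also have "\<dots> = exp (- (L / 12))" by (simp flip: exp_add)
      finally have 2: "measure M {\<omega> \<in> space M. ennreal_of_enat (waiting_time n (\<xi> n) F \<omega>) \<le> ennreal (exp (L / 4))}
          \<le> exp (- (L / 12))" .
      show "ennreal (exp (lam * real n powr (1/3) / (3 * ln (real n) ^ 6)))
            < (\<integral>\<^sup>+\<omega>. ennreal_of_enat (waiting_time n (\<xi> n) F \<omega>) \<partial>M) \<and>
          measure M {\<omega> \<in> space M. ennreal_of_enat (waiting_time n (\<xi> n) F \<omega>)
              \<le> ennreal (exp (lam * real n powr (1/3) / (4 * ln (real n) ^ 6)))}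
          \<le> exp (- (lam * real n powr (1/3) / (12 * ln (real n) ^ 6)))"
        unfolding L3 L4 L12 using 1 2 by blast
    qed
  qed
qed

end
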